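(* There exists a quasiregular map of transcendental type $g:\mathbb{R}^3\to\mathbb{R}^3$ that is equal to the identity map in a half-space.
   Context: A continuous map $g:\mathbb{R}^3\to\mathbb{R}^3$ is quasiregular if $g\in W^1_{3,loc}(\mathbb{R}^3)$ (all first order weak partial derivatives exist and are locally in $L^3$) and there is $K_O\ge1$ with $|Dg(x)|^3\le K_O J_g(x)$ a.e., where $|Dg(x)|=\sup_{|h|=1}|Dg(x)(h)|$ and $J_g$ is the Jacobian determinant. It is of transcendental type if it has an essential singularity at infinity, i.e. $g(x)$ has no limit in $\mathbb{R}^3\cup\{\infty\}$ as $x\to\infty$. *)

theory Defs
  imports "HOL-Analysis.Analysis"
begin

definition partial_deriv :: "'n::finite \<Rightarrow> (real^'n \<Rightarrow> real) \<Rightarrow> real^'n \<Rightarrow> real" where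
  "partial_deriv i f x = frechet_derivative f (at x) (axis i 1)"

primrec k_times_cont_diff :: "nat \<Rightarrow> (real^'n::finite \<Rightarrow> real) \<Rightarrow> bool" where
  "k_times_cont_diff 0 f \<longleftrightarrow> continuous_on UNIV f"
| "k_times_cont_diff (Suc k) f \<longleftrightarrow>
     (\<forall>x. f differentiable (at x)) \<and> (\<forall>i. k_times_cont_diff k (partial_deriv i f))"

definition test_function :: "(real^'n::finite \<Rightarrow> real) \<Rightarrow> bool" where
  "test_function \<phi> \<longleftrightarrow>
     (\<forall>k. k_times_cont_diff k \<phi>) \<and> compact (closure {x. \<phi> x \<noteq> 0})"

(* Measurability is required separately: integrability of the p-th power of the
   absolute value does not imply it. *)
definition Lp_loc :: "nat \<Rightarrow> (real^'n::finite \<Rightarrow> real) \<Rightarrow> bool" where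
  "Lp_loc p f \<longleftrightarrow> f \<in> borel_measurable lebesgue \<and>
     (\<forall>K. compact K \<longrightarrow> set_integrable lebesgue K (\<lambda>x. \<bar>f x\<bar> ^ p))"

definition weak_partial_deriv ::
    "'n::finite \<Rightarrow> (real^'n \<Rightarrow> real) \<Rightarrow> (real^'n \<Rightarrow> real) \<Rightarrow> bool" where
  "weak_partial_deriv i u v \<longleftrightarrow> Lp_loc 1 u \<and> Lp_loc 1 v \<and>
     (\<forall>\<phi>. test_function \<phi> \<longrightarrow>
        (LINT x|lebesgue. u x * partial_deriv i \<phi> x) = - (LINT x|lebesgue. v x * \<phi> x))"

(* D x is the Jacobian matrix of weak partial derivatives, with rows indexed by the
   components of g; such a D is determined by g up to a null set. *)
definition W1p_loc_deriv ::
    "nat \<Rightarrow> (real^'n::finite \<Rightarrow> real^'m::finite) \<Rightarrow> (real^'n \<Rightarrow> real^'n^'m) \<Rightarrow> bool" where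
  "W1p_loc_deriv p g D \<longleftrightarrow>
     (\<forall>j. Lp_loc p (\<lambda>x. g x $ j)) \<and>
     (\<forall>i j. weak_partial_deriv i (\<lambda>x. g x $ j) (\<lambda>x. D x $ j $ i) \<and>
            Lp_loc p (\<lambda>x. D x $ j $ i))"

definition quasiregular :: "(real^3 \<Rightarrow> real^3) \<Rightarrow> bool" where
  "quasiregular g \<longleftrightarrow> continuous_on UNIV g \<and>
     (\<exists>D. W1p_loc_deriv 3 g D \<and>
       (\<exists>K\<ge>1. AE x in lebesgue. onorm ((*v) (D x)) ^ 3 \<le> K * det (D x)))"

lemma onorm_matrix_eq_SUP_sphere:
  fixes A :: "real^'n::finite^'m::finite"
  shows "onorm ((*v) A) = (SUP h\<in>sphere 0 1. norm (A *v h))"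
proof (rule antisym)
  have bl: "bounded_linear ((*v) A)"
    by (simp add: matrix_vector_mul_bounded_linear)
  have le: "norm (A *v h) \<le> onorm ((*v) A)" if "h \<in> sphere 0 1" for h
    using onorm[OF bl, of h] that by simp
  have ne: "axis undefined 1 \<in> (sphere 0 1 :: (real^'n) set)"
    by simp
  have bdd: "bdd_above ((\<lambda>h. norm (A *v h)) ` sphere 0 1)"
    using le by (auto intro!: bdd_aboveI)
  show "(SUP h\<in>sphere 0 1. norm (A *v h)) \<le> onorm ((*v) A)"
    using ne le by (intro cSUP_least) auto
  show "onorm ((*v) A) \<le> (SUP h\<in>sphere 0 1. norm (A *v h))" (is "_ \<le> ?S")
  proof (rule onorm_le)
    fix x :: "real^'n"
    show "norm (A *v x) \<le> ?S * norm x"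
    proof (cases "x = 0")
      case False
      have "norm (A *v sgn x) \<le> ?S"
        using False by (intro cSUP_upper bdd) (simp add: norm_sgn)
      moreover have "A *v sgn x = (1 / norm x) *\<^sub>R (A *v x)"
        by (simp add: sgn_div_norm matrix_vector_mult_scaleR divide_inverse)
      ultimately show ?thesis
        using False by (simp add: field_simps)
    qed simp
  qed
qed

definition transcendental_type :: "(real^3 \<Rightarrow> real^3) \<Rightarrow> bool" where
  "transcendental_type g \<longleftrightarrow>
     \<not> (\<exists>l. (g \<longlongrightarrow> l) at_infinity) \<and> \<not> filterlim g at_infinity at_infinity"

definition half_space :: "(real^3) set \<Rightarrow> bool" where
  "half_space H \<longleftrightarrow> (\<exists>a b. a \<noteq> 0 \<and> H = {x. a \<bullet> x > b})"

end

theory Submission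
  imports Defs
begin

text \<open>
  The map is a piecewise linear interpolation between the identity and a Zorich type map.
  Above height 2 it equals \<open>(x, y, 3) + exp (z - 2) h(x, y)\<close>, where \<open>h\<close> is the
  doubly periodic map that rolls the triangulated plane onto the surface of a tetrahedron around
  the origin, so that every lattice line \<open>{(i, j)} \<times> \<real>\<close> is a branch line of index 2. Branch lines
  cannot end, hence \<open>id + s h\<close> with \<open>s\<close> running from 0 to \<open>\<infinity>\<close> is never quasiregular; they have to
  be joined in pairs by U-turns. This happens in the layer \<open>1 \<le> z \<le> 2\<close>, where the map interpolates
  linearly over the Kuhn triangulation of the unit cubes, between the graph of a positive function
  (reached from the identity by stretching vertical lines in \<open>0 \<le> z \<le> 1\<close>) and the first surface
  \<open>z = 2\<close> of the Zorich type part. The coefficients were found by a computer search that makes all 24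
  determinants of the layer positive.

  The map is locally Lipschitz and differentiable off countably many planes, and its derivative
  is bounded by a constant times \<open>e\<close> while the Jacobian is at least \<open>e\<^sup>3\<close>, with \<open>e\<close> the exponential
  growth factor. It is of transcendental type because some points of every level \<open>z = 2 + ln (2 n + 2)\<close>
  go to the plane \<open>z = 0\<close> and can be moved there into a bounded set by the lattice of periods.
\<close>

section \<open>Weak derivatives of locally Lipschitz functions\<close>

text \<open>One constant per ball rather than a global one, because the map grows like
  \<open>exp\<close>. Members of this class are bounded on balls, so the class is closed under
  products and under composition with \<open>exp\<close>.\<close>

definition lipschitz_on_balls :: "('a::real_normed_vector \<Rightarrow> 'b::metric_space) \<Rightarrow> bool" where
  "lipschitz_on_balls f \<longleftrightarrow> (\<forall>R. \<exists>L. L-lipschitz_on (cball 0 R) f)"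

lemma lipschitz_on_balls_continuous:
  assumes "lipschitz_on_balls f"
  shows "continuous_on UNIV f"
proof -
  have "isCont f x" for x
  proof -
    obtain L where "L-lipschitz_on (cball 0 (norm x + 1)) f"
      using assms unfolding lipschitz_on_balls_def by blast
    then have "continuous_on (ball 0 (norm x + 1)) f"
      by (metis ball_subset_cball continuous_on_subset lipschitz_on_continuous_on)
    then show ?thesis
      by (simp add: continuous_on_eq_continuous_at)
  qed
  then show ?thesis
    by (simp add: continuous_at_imp_continuous_on)
qed

lemma lipschitz_on_balls_bounded:
  fixes f :: "'a::real_normed_vector \<Rightarrow> 'b::real_normed_vector"
  assumes "lipschitz_on_balls f"
  shows "\<exists>B\<ge>0. \<forall>x. norm x \<le> R \<longrightarrow> norm (f x) \<le> B"
proof -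
  obtain L where L: "L-lipschitz_on (cball 0 R) f"
    using assms unfolding lipschitz_on_balls_def by blast
  \<comment> \<open>For negative \<open>R\<close> the claim is vacuous; the absolute value keeps the
    bound nonnegative in that case too.\<close>
  have "norm (f x) \<le> norm (f 0) + L * \<bar>R\<bar>" if "norm x \<le> R" for x
  proof -
    have "R \<ge> 0"
      using that norm_ge_zero[of x] by linarith
    then have "norm (f x - f 0) \<le> L * norm x"
      using lipschitz_onD[OF L, of x 0] that by (simp add: dist_norm)
    also have "\<dots> \<le> L * \<bar>R\<bar>"
      using that lipschitz_on_nonneg[OF L] by (intro mult_left_mono) auto
    finally show ?thesis
      using norm_triangle_sub[of "f x" "f 0"] by linarith
  qed
  then show ?thesis
    using lipschitz_on_nonneg[OF L] by (intro exI[of _ "norm (f 0) + L * \<bar>R\<bar>"]) simp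
qed

lemma lipschitz_on_balls_const [simp]: "lipschitz_on_balls (\<lambda>x. c)"
  unfolding lipschitz_on_balls_def using lipschitz_on_constant by blast

text \<open>For a function of several arguments, \<open>h\<close> is taken to be the tuple of the
  arguments. Then \<open>min\<close>, \<open>max\<close> and the folds only require a pointwise
  estimate.\<close>

lemma lipschitz_on_balls_dominated:
  fixes f :: "'a::real_normed_vector \<Rightarrow> real"
  assumes h: "lipschitz_on_balls h"
    and f: "\<And>x y. \<bar>f x - f y\<bar> \<le> C * dist (h x) (h y)" and "C \<ge> 0"
  shows "lipschitz_on_balls f"
  unfolding lipschitz_on_balls_def
proof
  fix R
  obtain L where L: "L-lipschitz_on (cball 0 R) h"
    using h unfolding lipschitz_on_balls_def by blast
  have "(C * L)-lipschitz_on (cball 0 R) f"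
  proof (rule lipschitz_onI)
    fix x y :: 'a assume "x \<in> cball 0 R" "y \<in> cball 0 R"
    then have "C * dist (h x) (h y) \<le> C * (L * dist x y)"
      by (intro mult_left_mono lipschitz_onD[OF L] \<open>C \<ge> 0\<close>)
    then show "dist (f x) (f y) \<le> C * L * dist x y"
      using f[of x y] by (simp add: dist_real_def)
  qed (use lipschitz_on_nonneg[OF L] \<open>C \<ge> 0\<close> in simp)
  then show "\<exists>L. L-lipschitz_on (cball 0 R) f"
    by blast
qed

lemma lipschitz_on_balls_Pair:
  assumes "lipschitz_on_balls f" "lipschitz_on_balls g"
  shows "lipschitz_on_balls (\<lambda>x. (f x, g x))"
  using assms unfolding lipschitz_on_balls_def by (blast intro: lipschitz_on_Pair)

lemma lipschitz_on_balls_add: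
  fixes f g :: "'a::real_normed_vector \<Rightarrow> real"
  assumes "lipschitz_on_balls f" "lipschitz_on_balls g"
  shows "lipschitz_on_balls (\<lambda>x. f x + g x)"
  using assms unfolding lipschitz_on_balls_def by (blast intro: lipschitz_on_add)

lemma lipschitz_on_balls_diff:
  fixes f g :: "'a::real_normed_vector \<Rightarrow> real"
  assumes "lipschitz_on_balls f" "lipschitz_on_balls g"
  shows "lipschitz_on_balls (\<lambda>x. f x - g x)"
  using assms unfolding lipschitz_on_balls_def by (blast intro: lipschitz_on_diff)

lemma lipschitz_on_balls_mult:
  fixes f g :: "'a::real_normed_vector \<Rightarrow> real"
  assumes f: "lipschitz_on_balls f" and g: "lipschitz_on_balls g"
  shows "lipschitz_on_balls (\<lambda>x. f x * g x)"
  unfolding lipschitz_on_balls_def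
proof
  fix R
  obtain L where L: "L-lipschitz_on (cball 0 R) f"
    using f unfolding lipschitz_on_balls_def by blast
  obtain M where M: "M-lipschitz_on (cball 0 R) g"
    using g unfolding lipschitz_on_balls_def by blast
  obtain B where B: "B \<ge> 0" "\<And>x. norm x \<le> R \<Longrightarrow> norm (f x) \<le> B"
    using lipschitz_on_balls_bounded[OF f, of R] by blast
  obtain C where C: "C \<ge> 0" "\<And>x. norm x \<le> R \<Longrightarrow> norm (g x) \<le> C"
    using lipschitz_on_balls_bounded[OF g, of R] by blast
  have "(B * M + C * L)-lipschitz_on (cball 0 R) (\<lambda>x. f x * g x)"
  proof (rule lipschitz_onI)
    fix x y :: 'a assume x: "x \<in> cball 0 R" and y: "y \<in> cball 0 R"
    have "f x * g x - f y * g y = f x * (g x - g y) + g y * (f x - f y)"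
      by (simp add: algebra_simps)
    then have "\<bar>f x * g x - f y * g y\<bar> \<le> \<bar>f x\<bar> * \<bar>g x - g y\<bar> + \<bar>g y\<bar> * \<bar>f x - f y\<bar>"
      by (metis abs_mult abs_triangle_ineq)
    also have "\<dots> \<le> B * (M * dist x y) + C * (L * dist x y)"
      using B C x y lipschitz_onD[OF L x y] lipschitz_onD[OF M x y]
      by (intro add_mono mult_mono) (auto simp: dist_real_def)
    finally show "dist (f x * g x) (f y * g y) \<le> (B * M + C * L) * dist x y"
      by (simp add: dist_real_def algebra_simps)
  qed (use B C lipschitz_on_nonneg[OF L] lipschitz_on_nonneg[OF M] in simp)
  then show "\<exists>L. L-lipschitz_on (cball 0 R) (\<lambda>x. f x * g x)"
    by blast
qed

lemma lipschitz_on_balls_exp: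
  fixes f :: "'a::real_normed_vector \<Rightarrow> real"
  assumes f: "lipschitz_on_balls f"
  shows "lipschitz_on_balls (\<lambda>x. exp (f x))"
  unfolding lipschitz_on_balls_def
proof
  fix R
  obtain L where L: "L-lipschitz_on (cball 0 R) f"
    using f unfolding lipschitz_on_balls_def by blast
  obtain B where B: "B \<ge> 0" "\<And>x. norm x \<le> R \<Longrightarrow> norm (f x) \<le> B"
    using lipschitz_on_balls_bounded[OF f, of R] by blast
  have "(exp B)-lipschitz_on {-B..B} (exp :: real \<Rightarrow> real)"
    by (rule bounded_derivative_imp_lipschitz[where f' = "\<lambda>x h. h * exp x"])
       (auto intro!: derivative_eq_intros onorm_le mult_left_mono simp: abs_mult mult.commute)
  then have "(exp B)-lipschitz_on (f ` cball 0 R) (exp :: real \<Rightarrow> real)"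
    using B by (rule_tac lipschitz_on_subset) (fastforce simp: abs_le_iff)+
  then have "(exp B * L)-lipschitz_on (cball 0 R) (\<lambda>x. exp (f x))"
    using lipschitz_on_compose2 L by blast
  then show "\<exists>L. L-lipschitz_on (cball 0 R) (\<lambda>x. exp (f x))"
    by blast
qed

section \<open>Local integrability and test functions\<close>

lemma Lp_loc_bounded:
  fixes f :: "real^'n \<Rightarrow> real"
  assumes m: "f \<in> borel_measurable lebesgue"
    and b: "\<And>R. \<exists>B. AE x in lebesgue. norm x \<le> R \<longrightarrow> \<bar>f x\<bar> \<le> B"
  shows "Lp_loc p f"
  unfolding Lp_loc_def
proof (intro conjI allI impI m)
  fix K :: "(real^'n) set" assume K: "compact K"
  obtain R where R: "\<And>x. x \<in> K \<Longrightarrow> norm x \<le> R"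
    using compact_imp_bounded[OF K] by (auto simp: bounded_iff)
  obtain B where B: "AE x in lebesgue. norm x \<le> R \<longrightarrow> \<bar>f x\<bar> \<le> B"
    using b by blast
  have Kl: "K \<in> lmeasurable"
    by (simp add: K lmeasurable_compact)
  have "set_integrable lebesgue K (\<lambda>x. \<bar>B\<bar> ^ p)"
    using Kl unfolding set_integrable_def lmeasurable_iff_integrable by (simp add: mult.commute)
  then show "set_integrable lebesgue K (\<lambda>x. \<bar>f x\<bar> ^ p)"
  proof (rule set_integrable_bound)
    show "set_borel_measurable lebesgue K (\<lambda>x. \<bar>f x\<bar> ^ p)"
      unfolding set_borel_measurable_def using m Kl by measurable
    show "AE x in lebesgue. x \<in> K \<longrightarrow> norm (\<bar>f x\<bar> ^ p) \<le> norm (\<bar>B\<bar> ^ p)"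
      using B by eventually_elim (auto dest!: R intro!: power_mono simp: power_abs)
  qed
qed

lemma borel_measurable_lebesgue_continuous:
  fixes f :: "'a::euclidean_space \<Rightarrow> 'b::euclidean_space"
  shows "continuous_on UNIV f \<Longrightarrow> f \<in> borel_measurable lebesgue"
  by (intro measurable_completion) (simp add: borel_measurable_continuous_onI)

lemma Lp_loc_lipschitz_on_balls:
  fixes f :: "real^'n \<Rightarrow> real"
  assumes f: "lipschitz_on_balls f"
  shows "Lp_loc p f"
proof (rule Lp_loc_bounded)
  show "f \<in> borel_measurable lebesgue"
    by (intro borel_measurable_lebesgue_continuous lipschitz_on_balls_continuous f)
  show "\<exists>B. AE x in lebesgue. norm x \<le> R \<longrightarrow> \<bar>f x\<bar> \<le> B" for R
  proof -
    obtain B where "\<forall>x. norm x \<le> R \<longrightarrow> norm (f x) \<le> B"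
      using lipschitz_on_balls_bounded[OF f, of R] by blast
    then show ?thesis
      by (intro exI[of _ B] AE_I2) simp
  qed
qed

text \<open>Collects what integration by parts uses: one continuous derivative, a radius beyond
  which the function vanishes, and a bound on the partial derivative, which exists because that
  derivative is continuous and vanishes outside the same ball.\<close>

lemma test_functionE:
  fixes \<phi> :: "real^'n \<Rightarrow> real"
  assumes "test_function \<phi>"
  obtains R C where "\<And>x. \<phi> differentiable (at x)" "continuous_on UNIV \<phi>"
    "continuous_on UNIV (partial_deriv i \<phi>)"
    "R > 0" "\<And>x. norm x > R \<Longrightarrow> \<phi> x = 0" "C \<ge> 0" "\<And>x. \<bar>partial_deriv i \<phi> x\<bar> \<le> C"
proof -
  have "k_times_cont_diff 1 \<phi>"
    using assms unfolding test_function_def by blast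
  then have d: "\<And>x. \<phi> differentiable (at x)" and c: "continuous_on UNIV (partial_deriv i \<phi>)"
    by auto
  have "bounded {x. \<phi> x \<noteq> 0}"
    using assms compact_imp_bounded bounded_subset[OF _ closure_subset]
    unfolding test_function_def by blast
  then obtain R where R: "R > 0" "\<And>x. \<phi> x \<noteq> 0 \<Longrightarrow> norm x \<le> R"
    unfolding bounded_pos by blast
  have z: "partial_deriv i \<phi> x = 0" if "norm x > R" for x
  proof -
    \<comment> \<open>On the open complement of the closed ball \<phi> coincides with the zero
      function, so its derivative there is that of a constant.\<close>
    have "0 = \<phi> y" if "y \<in> - cball 0 R" for y
      using R(2)[of y] that by force
    then have "(\<phi> has_derivative (\<lambda>h. 0)) (at x)"
      using \<open>norm x > R\<close>
      by (intro has_derivative_transform_within_open[of "\<lambda>y. 0" "\<lambda>h. 0" x UNIV "- cball 0 R" \<phi>])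
         (auto simp: open_Compl)
    then show ?thesis
      unfolding partial_deriv_def by (simp add: frechet_derivative_at[symmetric])
  qed
  have "compact (partial_deriv i \<phi> ` cball 0 R)"
    by (intro compact_continuous_image continuous_on_subset[OF c]) auto
  then have "bounded (partial_deriv i \<phi> ` cball 0 R)"
    by (rule compact_imp_bounded)
  then obtain C where "\<forall>x\<in>cball 0 R. \<bar>partial_deriv i \<phi> x\<bar> \<le> C"
    unfolding bounded_iff by auto
  then have C: "\<And>x. norm x \<le> R \<Longrightarrow> \<bar>partial_deriv i \<phi> x\<bar> \<le> C"
    by auto
  show ?thesis
  proof (rule that[OF d _ c R(1)])
    show "continuous_on UNIV \<phi>"
      by (simp add: continuous_at_imp_continuous_on d differentiable_imp_continuous_within)
    show "\<phi> x = 0" if "norm x > R" for x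
      using R(2)[of x] that by linarith
    show "C \<ge> 0"
      using C[of 0] R(1) by simp
    show "\<bar>partial_deriv i \<phi> x\<bar> \<le> C" for x
      using C[of x] z[of x] \<open>C \<ge> 0\<close> by (cases "norm x \<le> R") auto
  qed
qed

lemma partial_deriv_along_axis:
  assumes "\<phi> differentiable (at (x + s *\<^sub>R axis i 1))"
  shows "((\<lambda>s. \<phi> (x + s *\<^sub>R axis i 1)) has_real_derivative partial_deriv i \<phi> (x + s *\<^sub>R axis i 1)) (at s)"
proof -
  let ?D = "frechet_derivative \<phi> (at (x + s *\<^sub>R axis i 1))"
  have "(\<phi> has_derivative ?D) (at (x + s *\<^sub>R axis i 1))"
    using assms frechet_derivative_works by blast
  moreover have "((\<lambda>s. x + s *\<^sub>R axis i 1) has_derivative (\<lambda>h. h *\<^sub>R axis i 1)) (at s)"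
    by (auto intro!: derivative_eq_intros)
  ultimately have "((\<lambda>s. \<phi> (x + s *\<^sub>R axis i 1)) has_derivative (\<lambda>h. ?D (h *\<^sub>R axis i 1))) (at s)"
    using has_derivative_compose by blast
  moreover have "?D (h *\<^sub>R axis i 1) = partial_deriv i \<phi> (x + s *\<^sub>R axis i 1) * h" for h
    unfolding partial_deriv_def
    using linear_cmul[OF linear_frechet_derivative[OF assms]] by (simp add: mult.commute)
  ultimately show ?thesis
    by (simp add: has_field_derivative_def)
qed

lemma partial_deriv_bound_diff:
  assumes d: "\<And>x. \<phi> differentiable (at x)" and C: "\<And>x. \<bar>partial_deriv i \<phi> x\<bar> \<le> C"
  shows "\<bar>\<phi> (x + s *\<^sub>R axis i 1) - \<phi> x\<bar> \<le> C * \<bar>s\<bar>"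
proof -
  have "norm (\<phi> (x + s *\<^sub>R axis i 1) - \<phi> (x + 0 *\<^sub>R axis i 1)) \<le> C * norm (s - 0)"
    by (rule field_differentiable_bound[of UNIV "\<lambda>s. \<phi> (x + s *\<^sub>R axis i 1)"
          "\<lambda>s. partial_deriv i \<phi> (x + s *\<^sub>R axis i 1)"])
       (auto intro: partial_deriv_along_axis d C)
  then show ?thesis
    by simp
qed

lemma integrable_lebesgue_indicator_cball:
  "integrable lebesgue (\<lambda>x. c * indicator (cball (0::'a::euclidean_space) R) x :: real)"
proof -
  have "integrable lebesgue (indicator (cball (0::'a) R) :: 'a \<Rightarrow> real)"
    by (rule lmeasurable_iff_integrable[THEN iffD1, OF lmeasurable_cball])
  then show ?thesis
    by simp
qed

lemma integrable_continuous_bounded_support: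
  fixes f :: "'a::euclidean_space \<Rightarrow> real"
  assumes f: "continuous_on UNIV f" and R: "\<And>x. norm x > R \<Longrightarrow> f x = 0"
  shows "integrable lebesgue f"
proof -
  have "compact (f ` cball 0 R)"
    by (intro compact_continuous_image continuous_on_subset[OF f]) auto
  then have "bounded (f ` cball 0 R)"
    by (rule compact_imp_bounded)
  then obtain B where B: "\<forall>x\<in>cball 0 R. \<bar>f x\<bar> \<le> B"
    unfolding bounded_iff by auto
  show ?thesis
  proof (rule Bochner_Integration.integrable_bound)
    show "integrable lebesgue (\<lambda>x. B * indicator (cball 0 R) x)"
      by (rule integrable_lebesgue_indicator_cball)
    show "AE x in lebesgue. norm (f x) \<le> norm (B * indicator (cball 0 R) x)"
    proof (rule AE_I2)
      fix x :: 'a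
      show "norm (f x) \<le> norm (B * indicator (cball 0 R) x)"
      proof (cases "norm x \<le> R")
        case True
        then have "\<bar>f x\<bar> \<le> B"
          using B by auto
        then show ?thesis
          using True by simp
      qed (use R[of x] in simp)
    qed
  qed (rule borel_measurable_lebesgue_continuous[OF f])
qed

section \<open>Translation invariance and difference quotients\<close>

lemma continuous_on_translation:
  fixes f :: "'a::real_normed_vector \<Rightarrow> 'b::topological_space"
  assumes "continuous_on UNIV f"
  shows "continuous_on UNIV (\<lambda>x. f (x + c))" "continuous_on UNIV (\<lambda>x. f (x - c))"
  by (rule continuous_on_compose2[OF assms], auto intro!: continuous_intros)+

lemma integral_lebesgue_translation:
  fixes f :: "'a::euclidean_space \<Rightarrow> real"
  assumes f: "continuous_on UNIV f"
  shows "(LINT x|lebesgue. f (x + c)) = (LINT x|lebesgue. f x)"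
proof -
  have m [measurable]: "f \<in> borel_measurable borel"
    using f by (rule borel_measurable_continuous_onI)
  have "(LINT x|lebesgue. f x) = (LINT x|distr lborel borel ((+) c). f x)"
    by (simp add: integral_completion lborel_distr_plus)
  also have "\<dots> = (LINT x|lborel. f (c + x))"
    by (rule integral_distr) auto
  also have "\<dots> = (LINT x|lborel. f (x + c))"
    by (simp only: add.commute)
  also have "\<dots> = (LINT x|lebesgue. f (x + c))"
    by (rule integral_completion[symmetric]) measurable
  finally show ?thesis
    by simp
qed

text \<open>The step lengths form a sequence, as dominated convergence and measurability of limits
  require; \<open>Suc n\<close> keeps them positive and at most 1.\<close>

definition forward_quotient :: "'n::finite \<Rightarrow> (real^'n \<Rightarrow> real) \<Rightarrow> nat \<Rightarrow> real^'n \<Rightarrow> real" where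
  "forward_quotient i u n x = real (Suc n) * (u (x + (1 / real (Suc n)) *\<^sub>R axis i 1) - u x)"

lemma norm_add_axis_le: "norm (x + (1 / real (Suc n)) *\<^sub>R axis i (1::real)) \<le> norm x + 1"
proof -
  have "norm ((1 / real (Suc n)) *\<^sub>R axis i (1::real)) \<le> 1"
    by simp
  then show ?thesis
    using norm_triangle_ineq[of x "(1 / real (Suc n)) *\<^sub>R axis i 1"] by linarith
qed

text \<open>The bound is uniform in \<open>n\<close> and later serves as dominating constant.
  Enlarging the radius by 1 keeps the shifted point inside the ball.\<close>

lemma forward_quotient_bound:
  assumes "lipschitz_on_balls u"
  obtains L where "\<And>n x. norm x \<le> R \<Longrightarrow> \<bar>forward_quotient i u n x\<bar> \<le> L"
proof -
  obtain L where L: "L-lipschitz_on (cball 0 (R + 1)) u"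
    using assms unfolding lipschitz_on_balls_def by blast
  have "\<bar>forward_quotient i u n x\<bar> \<le> L" if x: "norm x \<le> R" for n x
  proof -
    let ?y = "x + (1 / real (Suc n)) *\<^sub>R axis i (1::real)"
    have "norm ?y \<le> R + 1"
      using norm_add_axis_le[of x n i] x by linarith
    then have "\<bar>u ?y - u x\<bar> \<le> L * dist ?y x"
      using lipschitz_onD[OF L, of ?y x] x by (simp add: dist_real_def)
    also have "dist ?y x = 1 / real (Suc n)"
      by (simp add: dist_norm)
    finally have "real (Suc n) * \<bar>u ?y - u x\<bar> \<le> real (Suc n) * (L * (1 / real (Suc n)))"
      by (intro mult_left_mono) auto
    then show ?thesis
      unfolding forward_quotient_def by (simp add: abs_mult)
  qed
  then show ?thesis
    using that by blast
qed

lemma continuous_on_forward_quotient: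
  "continuous_on UNIV u \<Longrightarrow> continuous_on UNIV (forward_quotient i u n)"
  unfolding forward_quotient_def
  by (intro continuous_on_mult continuous_on_diff continuous_on_const continuous_on_translation)

text \<open>Moving the difference quotient from the test function to \<open>u\<close> by translation invariance
  reduces the weak derivative formula to two applications of dominated convergence.\<close>

lemma
  fixes u v :: "real^'n \<Rightarrow> real"
  assumes u: "lipschitz_on_balls u"
    and v: "v \<in> borel_measurable lebesgue"
    and lim: "AE x in lebesgue. (\<lambda>n. forward_quotient i u n x) \<longlonglongrightarrow> v x"
  shows Lp_loc_forward_quotient_limit: "Lp_loc p v"
    and weak_partial_deriv_forward_quotient: "weak_partial_deriv i u v"
proof -
  show Lp: "Lp_loc p v" for p
  proof (rule Lp_loc_bounded[OF v])
    fix R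
    obtain L where L: "\<And>n x. norm x \<le> R \<Longrightarrow> \<bar>forward_quotient i u n x\<bar> \<le> L"
      using forward_quotient_bound[OF u] by blast
    have "AE x in lebesgue. norm x \<le> R \<longrightarrow> \<bar>v x\<bar> \<le> L"
      using lim
    proof eventually_elim
      case (elim x)
      then have "(\<lambda>n. \<bar>forward_quotient i u n x\<bar>) \<longlonglongrightarrow> \<bar>v x\<bar>"
        by (rule tendsto_rabs)
      then show ?case
        using L LIMSEQ_le_const2 by blast
    qed
    then show "\<exists>B. AE x in lebesgue. norm x \<le> R \<longrightarrow> \<bar>v x\<bar> \<le> B"
      by blast
  qed
  have cu: "continuous_on UNIV u"
    by (rule lipschitz_on_balls_continuous[OF u])
  show "weak_partial_deriv i u v"
    unfolding weak_partial_deriv_def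
  proof (intro conjI allI impI)
    show "Lp_loc 1 u" "Lp_loc 1 v"
      by (rule Lp_loc_lipschitz_on_balls[OF u], rule Lp)
    fix \<phi> :: "real^'n \<Rightarrow> real" assume "test_function \<phi>"
    then obtain R C where \<phi>: "\<And>x. \<phi> differentiable (at x)" "continuous_on UNIV \<phi>"
      "continuous_on UNIV (partial_deriv i \<phi>)"
      and R: "R > 0" "\<And>x. norm x > R \<Longrightarrow> \<phi> x = 0"
      and C: "C \<ge> 0" "\<And>x. \<bar>partial_deriv i \<phi> x\<bar> \<le> C"
      by (rule test_functionE) blast
    define e :: "real^'n" where "e = axis i 1"
    define h where "h n = 1 / real (Suc n)" for n
    have h: "h n > 0" "h n \<le> 1" "real (Suc n) * h n = 1" for n
      by (auto simp: h_def)
    have "h \<longlonglongrightarrow> 0"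
      unfolding h_def by (rule LIMSEQ_Suc[OF lim_1_over_n])
    \<comment> \<open>\<open>A n\<close> carries the backward quotient of \<phi>: substituting
      \<open>x + h n *\<^sub>R e\<close> for \<open>x\<close> turns it into minus the forward
      quotient of \<open>u\<close>.\<close>
    define A where "A n x = u x * (real (Suc n) * (\<phi> x - \<phi> (x - h n *\<^sub>R e)))" for n x
    \<comment> \<open>The shift has length at most 1, so \<open>A n\<close> vanishes outside the
      ball of radius \<open>R + 1\<close>. Inside, \<open>B * C\<close> dominates it:
      \<open>B\<close> bounds \<open>u\<close>, and \<open>C\<close> bounds the quotient by the mean
      value estimate.\<close>
    have norm_shift: "norm (x - h n *\<^sub>R e) > R" if "norm x > R + 1" for x n
      using norm_triangle_ineq2[of x "h n *\<^sub>R e"] h(1,2)[of n] that by (simp add: e_def)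
    obtain B where B: "B \<ge> 0" "\<And>x. norm x \<le> R + 1 \<Longrightarrow> \<bar>u x\<bar> \<le> B"
      using lipschitz_on_balls_bounded[OF u, of "R + 1"] by auto
    have "(\<lambda>n. LINT x|lebesgue. A n x) \<longlonglongrightarrow> (LINT x|lebesgue. u x * partial_deriv i \<phi> x)"
    proof (rule integral_dominated_convergence)
      show "integrable lebesgue (\<lambda>x. (B * C) * indicator (cball (0::real^'n) (R + 1)) x)"
        by (rule integrable_lebesgue_indicator_cball)
      show "(\<lambda>x. u x * partial_deriv i \<phi> x) \<in> borel_measurable lebesgue"
        by (intro borel_measurable_lebesgue_continuous continuous_on_mult cu \<phi>)
      show "A n \<in> borel_measurable lebesgue" for n
        unfolding A_def
        by (intro borel_measurable_lebesgue_continuous continuous_on_mult continuous_on_diff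
            continuous_on_const continuous_on_translation cu \<phi>)
      show "AE x in lebesgue. (\<lambda>n. A n x) \<longlonglongrightarrow> u x * partial_deriv i \<phi> x"
      proof (rule AE_I2)
        fix x
        have "((\<lambda>s. \<phi> (x + s *\<^sub>R e)) has_real_derivative partial_deriv i \<phi> x) (at 0)"
          using partial_deriv_along_axis[of \<phi> x 0 i] \<phi>(1) by (simp add: e_def)
        then have "((\<lambda>s. (\<phi> (x + s *\<^sub>R e) - \<phi> x) / s) \<longlongrightarrow> partial_deriv i \<phi> x) (at 0)"
          by (simp add: DERIV_def)
        \<comment> \<open>Backward quotients are difference quotients with increments
          \<open>- h n\<close>, which tend to 0 without being 0.\<close>
        moreover have "filterlim (\<lambda>n. - h n) (at 0) sequentially"
          using tendsto_minus[OF \<open>h \<longlonglongrightarrow> 0\<close>] h(1)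
          by (intro filterlim_atI) (auto simp: less_imp_neq[THEN not_sym])
        ultimately have "(\<lambda>n. (\<phi> (x + (- h n) *\<^sub>R e) - \<phi> x) / (- h n)) \<longlonglongrightarrow> partial_deriv i \<phi> x"
          by (rule filterlim_compose)
        moreover have "(\<phi> (x + (- h n) *\<^sub>R e) - \<phi> x) / (- h n) = real (Suc n) * (\<phi> x - \<phi> (x - h n *\<^sub>R e))" for n
          by (simp add: h_def field_simps)
        ultimately show "(\<lambda>n. A n x) \<longlonglongrightarrow> u x * partial_deriv i \<phi> x"
          unfolding A_def by (intro tendsto_mult tendsto_const) simp
      qed
      show "AE x in lebesgue. norm (A n x) \<le> B * C * indicator (cball 0 (R + 1)) x" for n
      proof (rule AE_I2)
        fix x
        show "norm (A n x) \<le> B * C * indicator (cball 0 (R + 1)) x"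
        proof (cases "norm x \<le> R + 1")
          case True
          have "\<bar>\<phi> x - \<phi> (x - h n *\<^sub>R e)\<bar> \<le> C * h n"
            using partial_deriv_bound_diff[OF \<phi>(1) C(2), of x "- h n"] h(1)[of n]
            by (simp add: e_def abs_minus_commute)
          then have "real (Suc n) * \<bar>\<phi> x - \<phi> (x - h n *\<^sub>R e)\<bar> \<le> real (Suc n) * (C * h n)"
            by (intro mult_left_mono) auto
          also have "\<dots> = C"
            using h(3)[of n] by (metis mult.commute mult.left_commute mult.right_neutral)
          finally have "\<bar>u x\<bar> * (real (Suc n) * \<bar>\<phi> x - \<phi> (x - h n *\<^sub>R e)\<bar>) \<le> B * C"
            using B True by (intro mult_mono) auto
          then show ?thesis
            using True by (simp add: A_def abs_mult)
        next
          case False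
          then show ?thesis
            using R(2)[of x] R(2)[OF norm_shift, of x n] by (simp add: A_def)
        qed
      qed
    qed
    moreover have "(LINT x|lebesgue. A n x) = - (LINT x|lebesgue. forward_quotient i u n x * \<phi> x)" for n
    proof -
      have c: "continuous_on UNIV (\<lambda>x. u x * \<phi> x)" "continuous_on UNIV (\<lambda>x. u x * \<phi> (x - h n *\<^sub>R e))"
        "continuous_on UNIV (\<lambda>x. u (x + h n *\<^sub>R e) * \<phi> x)"
        by (intro continuous_on_mult continuous_on_translation cu \<phi>)+
      have i: "integrable lebesgue (\<lambda>x. u x * \<phi> x)" "integrable lebesgue (\<lambda>x. u x * \<phi> (x - h n *\<^sub>R e))"
        "integrable lebesgue (\<lambda>x. u (x + h n *\<^sub>R e) * \<phi> x)"
        by (rule integrable_continuous_bounded_support[OF c(1), of R], use R in simp,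
            rule integrable_continuous_bounded_support[OF c(2), of "R + 1"], use R norm_shift in simp,
            rule integrable_continuous_bounded_support[OF c(3), of R], use R in simp)
      have "(LINT x|lebesgue. A n x)
          = real (Suc n) * ((LINT x|lebesgue. u x * \<phi> x) - (LINT x|lebesgue. u x * \<phi> (x - h n *\<^sub>R e)))"
        unfolding A_def
        by (subst Bochner_Integration.integral_diff[OF i(1,2), symmetric],
            subst integral_mult_right_zero[symmetric]) (simp add: algebra_simps)
      also have "(LINT x|lebesgue. u x * \<phi> (x - h n *\<^sub>R e)) = (LINT x|lebesgue. u (x + h n *\<^sub>R e) * \<phi> x)"
        using integral_lebesgue_translation[OF c(2), of "h n *\<^sub>R e"] by simp
      also have "real (Suc n) * ((LINT x|lebesgue. u x * \<phi> x) - \<dots>)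
          = - (LINT x|lebesgue. forward_quotient i u n x * \<phi> x)"
        unfolding forward_quotient_def
        by (subst Bochner_Integration.integral_diff[OF i(1,3), symmetric],
            subst integral_mult_right_zero[symmetric], subst integral_minus[symmetric])
           (simp add: algebra_simps e_def h_def)
      finally show ?thesis .
    qed
    moreover have "(\<lambda>n. LINT x|lebesgue. forward_quotient i u n x * \<phi> x) \<longlonglongrightarrow> (LINT x|lebesgue. v x * \<phi> x)"
    proof -
      obtain L where L: "\<And>n x. norm x \<le> R \<Longrightarrow> \<bar>forward_quotient i u n x\<bar> \<le> L"
        using forward_quotient_bound[OF u] by blast
      have "integrable lebesgue \<phi>"
        by (rule integrable_continuous_bounded_support[OF \<phi>(2) R(2)])
      show ?thesis
      proof (rule integral_dominated_convergence)
        \<comment> \<open>\<open>L\<close> bounds the quotients only on the ball of radius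
          \<open>R\<close>, which suffices because \<phi> is 0 outside it.\<close>
        show "integrable lebesgue (\<lambda>x. L * \<bar>\<phi> x\<bar>)"
          using \<open>integrable lebesgue \<phi>\<close> by (intro integrable_mult_right integrable_abs)
        show "(\<lambda>x. v x * \<phi> x) \<in> borel_measurable lebesgue"
          by (intro borel_measurable_times v borel_measurable_lebesgue_continuous \<phi>)
        show "(\<lambda>x. forward_quotient i u n x * \<phi> x) \<in> borel_measurable lebesgue" for n
          by (intro borel_measurable_lebesgue_continuous continuous_on_mult \<phi>
              continuous_on_forward_quotient[OF cu])
        show "AE x in lebesgue. (\<lambda>n. forward_quotient i u n x * \<phi> x) \<longlonglongrightarrow> v x * \<phi> x"
          using lim by eventually_elim (intro tendsto_mult tendsto_const)
        show "AE x in lebesgue. norm (forward_quotient i u n x * \<phi> x) \<le> L * \<bar>\<phi> x\<bar>" for n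
        proof (rule AE_I2)
          fix x show "norm (forward_quotient i u n x * \<phi> x) \<le> L * \<bar>\<phi> x\<bar>"
            using L[of x n] R(2)[of x]
            by (cases "norm x \<le> R") (auto simp: abs_mult intro: mult_right_mono)
        qed
      qed
    qed
    ultimately show "(LINT x|lebesgue. u x * partial_deriv i \<phi> x) = - (LINT x|lebesgue. v x * \<phi> x)"
      using LIMSEQ_unique[OF _ tendsto_minus] by simp
  qed
qed

lemma forward_quotient_tendsto:
  assumes "(u has_derivative u') (at x)"
  shows "(\<lambda>n. forward_quotient i u n x) \<longlonglongrightarrow> u' (axis i 1)"
proof -
  define e :: "real^'a" where "e = axis i 1"
  have "(u has_derivative u') (at (x + 0 *\<^sub>R e))"
    using assms by simp
  moreover have "((\<lambda>s. x + s *\<^sub>R e) has_derivative (\<lambda>h. h *\<^sub>R e)) (at 0)"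
    by (auto intro!: derivative_eq_intros)
  ultimately have "((\<lambda>s. u (x + s *\<^sub>R e)) has_derivative (\<lambda>h. u' (h *\<^sub>R e))) (at 0)"
    by (rule has_derivative_compose[rotated])
  moreover have "u' (h *\<^sub>R e) = u' e * h" for h
    using linear_cmul[OF has_derivative_linear[OF assms]] by (simp add: mult.commute)
  ultimately have "((\<lambda>s. u (x + s *\<^sub>R e)) has_real_derivative u' e) (at 0)"
    by (simp add: has_field_derivative_def)
  then have "((\<lambda>s. (u (x + s *\<^sub>R e) - u x) / s) \<longlongrightarrow> u' e) (at 0)"
    by (simp add: DERIV_def)
  moreover have "filterlim (\<lambda>n. 1 / real (Suc n)) (at 0) sequentially"
    by (intro filterlim_atI LIMSEQ_Suc[OF lim_1_over_n]) auto
  ultimately have "(\<lambda>n. (u (x + (1 / real (Suc n)) *\<^sub>R e) - u x) / (1 / real (Suc n))) \<longlonglongrightarrow> u' e"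
    by (rule filterlim_compose)
  then show ?thesis
    by (simp add: forward_quotient_def e_def mult.commute)
qed

section \<open>A criterion for quasiregularity\<close>

lemma quasiregularI:
  fixes g :: "real^3 \<Rightarrow> real^3"
  assumes lip: "\<And>j. lipschitz_on_balls (\<lambda>x. g x $ j)"
    and K: "K \<ge> 1"
    and AE: "AE x in lebesgue. \<exists>M. (g has_derivative (*v) M) (at x) \<and> onorm ((*v) M) ^ 3 \<le> K * det M"
  shows "quasiregular g"
proof -
  \<comment> \<open>Taking the limit of the quotients at every point, instead of the derivative
    where it exists, makes each entry measurable at once. Where there is no limit \<open>lim\<close>
    has an arbitrary value, but this can happen only on a null set.\<close>
  define D :: "real^3 \<Rightarrow> real^3^3"
    where "D x = (\<chi> j i. lim (\<lambda>n. forward_quotient i (\<lambda>x. g x $ j) n x))" for x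
  have cont: "continuous_on UNIV (\<lambda>x. g x $ j)" for j
    by (rule lipschitz_on_balls_continuous[OF lip])
  have lim_comp: "(\<lambda>n. forward_quotient i (\<lambda>x. g x $ j) n x) \<longlonglongrightarrow> M $ j $ i"
    if "(g has_derivative (*v) M) (at x)" for x M i j
  proof -
    have "((\<lambda>x. g x $ j) has_derivative (\<lambda>h. (M *v h) $ j)) (at x)"
      using bounded_linear.has_derivative[OF bounded_linear_vec_nth that] .
    from forward_quotient_tendsto[OF this, of i] show ?thesis
      by (simp add: matrix_vector_mul_component inner_axis)
  qed
  have D: "D x = M" if "(g has_derivative (*v) M) (at x)" for x M
    using limI[OF lim_comp[OF that]] by (simp add: D_def vec_eq_iff)
  have meas: "(\<lambda>x. D x $ j $ i) \<in> borel_measurable lebesgue" for i j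
  proof -
    have "(\<lambda>x. lim (\<lambda>n. forward_quotient i (\<lambda>x. g x $ j) n x)) \<in> borel_measurable lebesgue"
      by (intro borel_measurable_lim_metric borel_measurable_lebesgue_continuous
          continuous_on_forward_quotient cont)
    then show ?thesis
      by (simp add: D_def)
  qed
  have lim: "AE x in lebesgue. (\<lambda>n. forward_quotient i (\<lambda>x. g x $ j) n x) \<longlonglongrightarrow> D x $ j $ i" for i j
    using AE
  proof eventually_elim
    case (elim x)
    then obtain M where "(g has_derivative (*v) M) (at x)"
      by blast
    then show ?case
      using lim_comp D by simp
  qed
  have "W1p_loc_deriv 3 g D"
    unfolding W1p_loc_deriv_def
  proof (intro conjI allI)
    show "Lp_loc 3 (\<lambda>x. g x $ j)" for j
      by (rule Lp_loc_lipschitz_on_balls[OF lip])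
    show "weak_partial_deriv i (\<lambda>x. g x $ j) (\<lambda>x. D x $ j $ i)" for i j
      by (rule weak_partial_deriv_forward_quotient[OF lip meas lim])
    show "Lp_loc 3 (\<lambda>x. D x $ j $ i)" for i j
      by (rule Lp_loc_forward_quotient_limit[OF lip meas lim])
  qed
  moreover have "AE x in lebesgue. onorm ((*v) (D x)) ^ 3 \<le> K * det (D x)"
    using AE
  proof eventually_elim
    case (elim x)
    then obtain M where "(g has_derivative (*v) M) (at x)" "onorm ((*v) M) ^ 3 \<le> K * det M"
      by blast
    then show ?case
      using D by simp
  qed
  moreover have "continuous_on UNIV g"
    using continuous_on_vec_lambda[of UNIV "\<lambda>j x. g x $ j"] cont by simp
  ultimately show ?thesis
    unfolding quasiregular_def using K by blast
qed

text \<open>The 9 counts the matrix entries. With \<open>e\<close> the exponential growth factor,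
  entries of order \<open>e\<close> and a determinant of order at least \<open>e ^ 3\<close> leave a
  dilatation independent of \<open>e\<close>.\<close>

lemma dilatation_bound:
  fixes M :: "real^3^3"
  assumes "\<And>i j. \<bar>M $ i $ j\<bar> \<le> c * e" "det M \<ge> e ^ 3" "c > 0" "e > 0"
  shows "onorm ((*v) M) ^ 3 \<le> (9 * c) ^ 3 * det M"
proof -
  have "onorm ((*v) M) \<le> 9 * (c * e)"
    using onorm_le_matrix_component[of M, OF assms(1)] by simp
  then have "onorm ((*v) M) ^ 3 \<le> (9 * (c * e)) ^ 3"
    by (rule power_mono) (rule onorm_pos_le[OF matrix_vector_mul_bounded_linear])
  also have "\<dots> = (9 * c) ^ 3 * e ^ 3"
    by (simp add: power_mult_distrib)
  also have "\<dots> \<le> (9 * c) ^ 3 * det M"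
    using assms by (intro mult_left_mono) auto
  finally show ?thesis .
qed

text \<open>The exceptional set is a countable union of hyperplanes. Applied to coordinates and
  their differences, this removes the walls of the triangulation, where the map may have
  kinks.\<close>

lemma AE_inner_not_Ints:
  fixes a :: "'a::euclidean_space"
  assumes "a \<noteq> 0"
  shows "AE x in lebesgue. a \<bullet> x \<notin> \<int>"
proof -
  have "{x. a \<bullet> x \<in> \<int>} = (\<Union>k. {x. a \<bullet> x = of_int k})"
    by (auto elim: Ints_cases)
  moreover have "negligible (\<Union>k::int. {x. a \<bullet> x = of_int k})"
    using assms by (intro negligible_countable_Union) (auto intro: negligible_hyperplane)
  ultimately have "{x. a \<bullet> x \<in> \<int>} \<in> null_sets lebesgue"
    by (simp add: negligible_iff_null_sets)
  from AE_not_in[OF this] show ?thesis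
    by simp
qed

lemma has_derivative_vecI:
  fixes f :: "'a::real_normed_vector \<Rightarrow> real^'n"
  assumes "\<And>i. ((\<lambda>x. f x $ i) has_derivative (\<lambda>h. f' h $ i)) (at x)"
  shows "(f has_derivative f') (at x)"
proof (rule has_derivative_componentwise_within[THEN iffD2], rule ballI)
  fix b :: "real^'n" assume "b \<in> Basis"
  then obtain i where b: "b = axis i 1"
    unfolding Basis_vec_def by auto
  show "((\<lambda>x. f x \<bullet> b) has_derivative (\<lambda>h. f' h \<bullet> b)) (at x)"
    unfolding b inner_axis using assms[of i] by simp
qed

lemma has_derivative_vector_3:
  fixes f1 f2 f3 :: "real^3 \<Rightarrow> real"
  assumes "(f1 has_derivative (\<lambda>h. a1 * h $ 1 + a2 * h $ 2 + a3 * h $ 3)) (at x)"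
    and "(f2 has_derivative (\<lambda>h. b1 * h $ 1 + b2 * h $ 2 + b3 * h $ 3)) (at x)"
    and "(f3 has_derivative (\<lambda>h. c1 * h $ 1 + c2 * h $ 2 + c3 * h $ 3)) (at x)"
  shows "((\<lambda>x. vector [f1 x, f2 x, f3 x] :: real^3) has_derivative
    (*v) (vector [vector [a1, a2, a3], vector [b1, b2, b3], vector [c1, c2, c3]])) (at x)"
    (is "(?f has_derivative (*v) ?M) (at x)")
proof (rule has_derivative_vecI)
  fix i :: 3
  have M: "(?M *v h) $ 1 = a1 * h $ 1 + a2 * h $ 2 + a3 * h $ 3"
    "(?M *v h) $ 2 = b1 * h $ 1 + b2 * h $ 2 + b3 * h $ 3"
    "(?M *v h) $ 3 = c1 * h $ 1 + c2 * h $ 2 + c3 * h $ 3" for h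
    unfolding matrix_vector_mult_def vec_lambda_beta sum_3 vector_3 by (rule refl)+
  have "\<forall>i. ((\<lambda>x. ?f x $ i) has_derivative (\<lambda>h. (?M *v h) $ i)) (at x)"
    unfolding forall_3 M vector_3 using assms by (intro conjI)
  then show "((\<lambda>x. ?f x $ i) has_derivative (\<lambda>h. (?M *v h) $ i)) (at x)"
    by (rule spec)
qed

section \<open>Folding functions\<close>

text \<open>
  \<open>fold1 t z\<close> and \<open>fold2 s t z\<close> are the integrals of \<open>- sq (t - r)\<close> and \<open>sq (s - r) * sq (t - r)\<close> over
  \<open>0 \<le> r \<le> z\<close>, for \<open>0 \<le> z \<le> 1\<close>. As functions of \<open>s, t, z\<close> they are linear on the simplices of the Kuhn
  triangulation; at \<open>z = 1\<close> they are triangle waves in \<open>t\<close> and in \<open>s - t\<close>.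
\<close>

definition sq :: "real \<Rightarrow> real" where
  "sq t = (if even \<lfloor>t\<rfloor> then 1 else -1)"

definition tri :: "real \<Rightarrow> real" where
  "tri t = (if even \<lfloor>t\<rfloor> then frac t else 1 - frac t)"

definition fold1 :: "real \<Rightarrow> real \<Rightarrow> real" where
  "fold1 t z = sq t * (z - 2 * min z (frac t))"

definition fold2 :: "real \<Rightarrow> real \<Rightarrow> real \<Rightarrow> real" where
  "fold2 s t z = sq s * sq t * (z - 2 * \<bar>min z (frac s) - min z (frac t)\<bar>)"

section \<open>Lipschitz estimates for the folds\<close>

lemma abs_sq [simp]: "\<bar>sq t\<bar> = 1"
  by (simp add: sq_def)

text \<open>With \<open>tri_eq_dist_even\<close> this identifies \<open>tri\<close> as the distance
  to the set of even integers, and a distance function is 1-Lipschitz.\<close>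

lemma tri_le_dist_even: "tri t \<le> \<bar>t - 2 * of_int k\<bar>"
proof (cases "even \<lfloor>t\<rfloor>")
  case True
  then obtain m where m: "\<lfloor>t\<rfloor> = 2 * m"
    by (rule evenE)
  \<comment> \<open>No integer lies strictly between \<open>m\<close> and \<open>m + 1\<close>, so
    the even integers nearest to \<open>t\<close> are \<open>2 * m\<close> and
    \<open>2 * m + 2\<close>.\<close>
  have "real_of_int k \<le> real_of_int m \<or> real_of_int (m + 1) \<le> real_of_int k"
    unfolding of_int_le_iff by linarith
  then show ?thesis
    using True m floor_correct[of t] by (auto simp: tri_def frac_def)
next
  case False
  then obtain m where m: "\<lfloor>t\<rfloor> = 2 * m + 1"
    by (rule oddE)
  have "real_of_int k \<le> real_of_int m \<or> real_of_int (m + 1) \<le> real_of_int k"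
    unfolding of_int_le_iff by linarith
  then show ?thesis
    using False m floor_correct[of t] by (auto simp: tri_def frac_def)
qed

lemma tri_eq_dist_even: "\<exists>k::int. tri t = \<bar>t - 2 * of_int k\<bar>"
proof (cases "even \<lfloor>t\<rfloor>")
  case True
  then obtain m where "\<lfloor>t\<rfloor> = 2 * m"
    by (rule evenE)
  then show ?thesis
    using True floor_correct[of t] by (intro exI[of _ m]) (auto simp: tri_def frac_def)
next
  case False
  then obtain m where "\<lfloor>t\<rfloor> = 2 * m + 1"
    by (rule oddE)
  then show ?thesis
    using False floor_correct[of t] by (intro exI[of _ "m + 1"]) (auto simp: tri_def frac_def)
qed

lemma tri_lipschitz: "\<bar>tri s - tri t\<bar> \<le> \<bar>s - t\<bar>"
proof -
  have "tri s \<le> \<bar>s - t\<bar> + tri t" for s t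
  proof -
    obtain k :: int where "tri t = \<bar>t - 2 * of_int k\<bar>"
      using tri_eq_dist_even by blast
    then show ?thesis
      using tri_le_dist_even[of s k] by linarith
  qed
  from this[of s t] this[of t s] show ?thesis
    by linarith
qed

text \<open>\<open>tri\<close> is a primitive of \<open>sq\<close>, so integrating
  \<open>- sq (t - r)\<close> over \<open>r\<close> gives a difference of two of its values. In this
  form it is visible that \<open>fold1\<close> does not jump where \<open>sq t\<close> does.\<close>

lemma fold1_eq_tri:
  assumes "0 \<le> z" "z \<le> 1"
  shows "fold1 t z = tri (t - z) - tri t"
proof (cases "z \<le> frac t")
  case True
  then have "\<lfloor>t - z\<rfloor> = \<lfloor>t\<rfloor>"
    using assms by (intro floor_unique; unfold frac_def; linarith)
  then show ?thesis
    using True by (auto simp: fold1_def tri_def sq_def frac_def)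
next
  case False
  then have "\<lfloor>t - z\<rfloor> = \<lfloor>t\<rfloor> - 1"
    using assms frac_lt_1[of t] by (intro floor_unique; unfold frac_def; linarith)
  then show ?thesis
    using False by (auto simp: fold1_def tri_def sq_def frac_def)
qed

text \<open>As \<open>sq (t - r)\<close> changes sign at \<open>r = frac t\<close>, the integral of
  the product splits there into two integrals of \<open>sq (s - r)\<close>. The algebra behind it is
  |p - q| = p + q - 2 min(p, q).\<close>

lemma fold2_eq_fold1:
  "fold2 s t z = sq t * (fold1 s z - 2 * fold1 s (min z (frac t)))"
proof -
  have "z - 2 * \<bar>min z (frac s) - min z (frac t)\<bar>
      = (z - 2 * min z (frac s)) - 2 * (min z (frac t) - 2 * min (min z (frac t)) (frac s))"
    by (auto simp: min_def abs_if)
  then show ?thesis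
    unfolding fold2_def fold1_def by (simp only: mult.assoc mult.left_commute right_diff_distrib)
qed

lemma fold2_commute: "fold2 s t z = fold2 t s z"
  by (simp add: fold2_def abs_minus_commute mult.commute)

lemma fold1_bound: "\<bar>fold1 t z\<bar> \<le> z" if "0 \<le> z"
proof -
  have "0 \<le> min z (frac t)" "min z (frac t) \<le> z"
    using that frac_ge_0[of t] by auto
  moreover have "\<bar>z - 2 * p\<bar> \<le> z" if "0 \<le> p" "p \<le> z" for p
    using that by linarith
  ultimately have "\<bar>z - 2 * min z (frac t)\<bar> \<le> z"
    by blast
  then show ?thesis
    by (simp add: fold1_def abs_mult)
qed

lemma fold2_bound: "\<bar>fold2 s t z\<bar> \<le> z" if "0 \<le> z"
proof -
  have "0 \<le> min z (frac s)" "min z (frac s) \<le> z" "0 \<le> min z (frac t)" "min z (frac t) \<le> z"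
    using that frac_ge_0[of t] frac_ge_0[of s] by auto
  moreover have "\<bar>z - 2 * \<bar>p - q\<bar>\<bar> \<le> z" if "0 \<le> p" "p \<le> z" "0 \<le> q" "q \<le> z" for p q
    using that by (auto simp: abs_if)
  ultimately have "\<bar>z - 2 * \<bar>min z (frac s) - min z (frac t)\<bar>\<bar> \<le> z"
    by blast
  then show ?thesis
    by (simp add: fold2_def abs_mult)
qed

lemma fold1_lipschitz:
  assumes "0 \<le> z" "z \<le> 1" "0 \<le> z'" "z' \<le> 1"
  shows "\<bar>fold1 t z - fold1 t' z'\<bar> \<le> 2 * \<bar>t - t'\<bar> + \<bar>z - z'\<bar>"
proof -
  have "\<bar>(t - z) - (t' - z')\<bar> \<le> \<bar>t - t'\<bar> + \<bar>z - z'\<bar>"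
    by linarith
  then have "\<bar>tri (t - z) - tri (t' - z')\<bar> + \<bar>tri t - tri t'\<bar> \<le> 2 * \<bar>t - t'\<bar> + \<bar>z - z'\<bar>"
    using tri_lipschitz[of t t'] tri_lipschitz[of "t - z" "t' - z'"] by linarith
  then show ?thesis
    unfolding fold1_eq_tri[OF assms(1,2)] fold1_eq_tri[OF assms(3,4)] by linarith
qed

text \<open>For fixed \<open>t\<close> the factor \<open>sq t\<close> is constant and
  \<open>fold2_eq_fold1\<close> gives the estimate in \<open>s\<close>; symmetry then gives the one
  in \<open>t\<close>, although \<open>sq t\<close> jumps. The 6 is 2 + 2 * 2 from
  \<open>fold1_lipschitz\<close>, the 3 is 1 + 2.\<close>

lemma fold2_lipschitz:
  assumes z: "0 \<le> z" "z \<le> 1" and z': "0 \<le> z'" "z' \<le> 1"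
  shows "\<bar>fold2 s t z - fold2 s' t' z'\<bar> \<le> 6 * \<bar>s - s'\<bar> + 6 * \<bar>t - t'\<bar> + 3 * \<bar>z - z'\<bar>"
proof -
  have 1: "\<bar>fold2 s t z - fold2 s' t z\<bar> \<le> 6 * \<bar>s - s'\<bar>" for s s' t
  proof -
    let ?m = "min z (frac t)"
    have m: "0 \<le> ?m" "?m \<le> 1"
      using z frac_ge_0[of t] by auto
    have "fold2 s t z - fold2 s' t z
        = sq t * ((fold1 s z - fold1 s' z) - 2 * (fold1 s ?m - fold1 s' ?m))"
      unfolding fold2_eq_fold1 by (simp add: algebra_simps)
    then have "\<bar>fold2 s t z - fold2 s' t z\<bar>
        = \<bar>(fold1 s z - fold1 s' z) - 2 * (fold1 s ?m - fold1 s' ?m)\<bar>"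
      by (simp only: abs_mult abs_sq mult_1_left)
    also have "\<dots> \<le> \<bar>fold1 s z - fold1 s' z\<bar> + \<bar>2 * (fold1 s ?m - fold1 s' ?m)\<bar>"
      by (rule abs_triangle_ineq4)
    also have "\<dots> \<le> 6 * \<bar>s - s'\<bar>"
      using fold1_lipschitz[OF z z, of s s'] fold1_lipschitz[OF m m, of s s']
      unfolding abs_mult by simp
    finally show ?thesis .
  qed
  have "\<bar>fold2 s' t' z - fold2 s' t' z'\<bar> \<le> 3 * \<bar>z - z'\<bar>"
  proof -
    let ?d = "\<lambda>z. \<bar>min z (frac s') - min z (frac t')\<bar>"
    have "\<bar>?d z - ?d z'\<bar> \<le> \<bar>z - z'\<bar>"
      by (auto simp: min_def abs_if)
    moreover have "\<bar>(z - 2 * p) - (z' - 2 * q)\<bar> \<le> 3 * \<bar>z - z'\<bar>" if "\<bar>p - q\<bar> \<le> \<bar>z - z'\<bar>" for p q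
      using that by (auto simp: abs_if split: if_splits)
    ultimately have "\<bar>(z - 2 * ?d z) - (z' - 2 * ?d z')\<bar> \<le> 3 * \<bar>z - z'\<bar>"
      by blast
    moreover have "fold2 s' t' z - fold2 s' t' z' = sq s' * sq t' * ((z - 2 * ?d z) - (z' - 2 * ?d z'))"
      by (simp add: fold2_def right_diff_distrib)
    ultimately show ?thesis
      by (simp only: abs_mult abs_sq mult_1_left)
  qed
  then show ?thesis
    using 1[of s t s'] 1[of t s' t'] fold2_commute[of s' t z] fold2_commute[of s' t' z] by linarith
qed

lemma lipschitz_on_balls_nth: "lipschitz_on_balls (\<lambda>x::real^'n. x $ k)"
proof (rule lipschitz_on_balls_dominated[where h = "\<lambda>x. x" and C = 1])
  show "lipschitz_on_balls (\<lambda>x::real^'n. x)"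
    unfolding lipschitz_on_balls_def using lipschitz_on_id by blast
  show "\<bar>x $ k - y $ k\<bar> \<le> 1 * dist x y" for x y :: "real^'n"
    using dist_vec_nth_le[of x k y] by (simp add: dist_real_def)
qed simp

lemma lipschitz_on_balls_min:
  fixes f g :: "'a::real_normed_vector \<Rightarrow> real"
  assumes "lipschitz_on_balls f" "lipschitz_on_balls g"
  shows "lipschitz_on_balls (\<lambda>x. min (f x) (g x))"
proof (rule lipschitz_on_balls_dominated[where C = 1, OF lipschitz_on_balls_Pair[OF assms]])
  fix x y
  have "\<bar>min (f x) (g x) - min (f y) (g y)\<bar> \<le> max \<bar>f x - f y\<bar> \<bar>g x - g y\<bar>"
    by (auto simp: min_def max_def)
  also have "\<dots> \<le> dist (f x, g x) (f y, g y)"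
    using dist_fst_le[of "(f x, g x)" "(f y, g y)"] dist_snd_le[of "(f x, g x)" "(f y, g y)"]
    by (simp add: dist_real_def)
  finally show "\<bar>min (f x) (g x) - min (f y) (g y)\<bar> \<le> 1 * dist (f x, g x) (f y, g y)"
    by simp
qed simp

lemma lipschitz_on_balls_max:
  fixes f g :: "'a::real_normed_vector \<Rightarrow> real"
  assumes "lipschitz_on_balls f" "lipschitz_on_balls g"
  shows "lipschitz_on_balls (\<lambda>x. max (f x) (g x))"
proof (rule lipschitz_on_balls_dominated[where C = 1, OF lipschitz_on_balls_Pair[OF assms]])
  fix x y
  have "\<bar>max (f x) (g x) - max (f y) (g y)\<bar> \<le> max \<bar>f x - f y\<bar> \<bar>g x - g y\<bar>"
    by (auto simp: max_def)
  also have "\<dots> \<le> dist (f x, g x) (f y, g y)"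
    using dist_fst_le[of "(f x, g x)" "(f y, g y)"] dist_snd_le[of "(f x, g x)" "(f y, g y)"]
    by (simp add: dist_real_def)
  finally show "\<bar>max (f x) (g x) - max (f y) (g y)\<bar> \<le> 1 * dist (f x, g x) (f y, g y)"
    by simp
qed simp

lemma lipschitz_on_balls_fold1:
  assumes "lipschitz_on_balls t" "lipschitz_on_balls z" and z: "\<And>x. 0 \<le> z x \<and> z x \<le> 1"
  shows "lipschitz_on_balls (\<lambda>x. fold1 (t x) (z x))"
proof (rule lipschitz_on_balls_dominated[where C = 3, OF lipschitz_on_balls_Pair[OF assms(1,2)]])
  show "\<bar>fold1 (t x) (z x) - fold1 (t y) (z y)\<bar> \<le> 3 * dist (t x, z x) (t y, z y)" for x y
    using fold1_lipschitz[of "z x" "z y" "t x" "t y"] z[of x] z[of y]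
      dist_fst_le[of "(t x, z x)" "(t y, z y)"] dist_snd_le[of "(t x, z x)" "(t y, z y)"]
    by (simp add: dist_real_def)
qed simp

lemma lipschitz_on_balls_fold2:
  assumes "lipschitz_on_balls s" "lipschitz_on_balls t" "lipschitz_on_balls z"
    and z: "\<And>x. 0 \<le> z x \<and> z x \<le> 1"
  shows "lipschitz_on_balls (\<lambda>x. fold2 (s x) (t x) (z x))"
proof (rule lipschitz_on_balls_dominated[where C = 15,
      OF lipschitz_on_balls_Pair[OF assms(1) lipschitz_on_balls_Pair[OF assms(2,3)]]])
  fix x y
  let ?p = "(s x, t x, z x)" and ?q = "(s y, t y, z y)"
  have s: "\<bar>s x - s y\<bar> \<le> dist ?p ?q"
    using dist_fst_le[of ?p ?q] by (simp add: dist_real_def)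
  have tz: "\<bar>t x - t y\<bar> \<le> dist ?p ?q" "\<bar>z x - z y\<bar> \<le> dist ?p ?q"
    using dist_fst_le[of "(t x, z x)" "(t y, z y)"] dist_snd_le[of "(t x, z x)" "(t y, z y)"]
      dist_snd_le[of ?p ?q] by (auto simp: dist_real_def intro: order_trans)
  have *: "6 * a + 6 * b + 3 * c \<le> 15 * d" if "a \<le> d" "b \<le> d" "c \<le> d" for a b c d :: real
    using that by linarith
  have "\<bar>fold2 (s x) (t x) (z x) - fold2 (s y) (t y) (z y)\<bar>
      \<le> 6 * \<bar>s x - s y\<bar> + 6 * \<bar>t x - t y\<bar> + 3 * \<bar>z x - z y\<bar>"
    by (rule fold2_lipschitz) (use z in auto)
  also have "\<dots> \<le> 15 * dist ?p ?q"
    by (rule *[OF s tz])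
  finally show "\<bar>fold2 (s x) (t x) (z x) - fold2 (s y) (t y) (z y)\<bar> \<le> 15 * dist ?p ?q" .
qed simp

section \<open>Derivatives of the folds off their walls\<close>

lemma has_derivative_transform_nhds:
  assumes "(f has_derivative f') (at x)" "eventually (\<lambda>y. f y = g y) (nhds x)"
  shows "(g has_derivative f') (at x)"
proof -
  obtain S where "open S" "x \<in> S" "\<And>y. y \<in> S \<Longrightarrow> f y = g y"
    using assms(2) unfolding eventually_nhds by blast
  then show ?thesis
    using has_derivative_transform_within_open[OF assms(1)] by blast
qed

lemma eventually_floor_nhds:
  fixes t :: "'a::t2_space \<Rightarrow> real"
  assumes "isCont t x" "t x \<notin> \<int>"
  shows "eventually (\<lambda>y. \<lfloor>t y\<rfloor> = \<lfloor>t x\<rfloor>) (nhds x)"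
proof -
  have "(t \<longlongrightarrow> t x) (nhds x)"
    using assms(1) by (simp add: continuous_at tendsto_at_iff_tendsto_nhds)
  then show ?thesis
    using assms(2) by (rule eventually_floor_eq)
qed

lemma eventually_sign_nhds:
  fixes d :: "'a::t2_space \<Rightarrow> real"
  assumes "isCont d x" "d x \<noteq> 0"
  shows "eventually (\<lambda>y. (d y < 0) = (d x < 0)) (nhds x)"
proof -
  have d: "(d \<longlongrightarrow> d x) (nhds x)"
    using assms(1) by (simp add: continuous_at tendsto_at_iff_tendsto_nhds)
  show ?thesis
  proof (cases "d x < 0")
    case True
    then show ?thesis
      using order_tendstoD(2)[OF d True] by (simp add: eventually_mono)
  next
    case False
    then have "0 < d x"
      using assms(2) by simp
    from order_tendstoD(1)[OF d this] show ?thesis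
      by eventually_elim (use False in simp)
  qed
qed

text \<open>Off the walls where \<open>t\<close> is an integer or \<open>frac t = z\<close>, neither
  the floor nor the active argument of \<open>min\<close> changes nearby, so the minimum becomes
  affine in \<open>t\<close> and \<open>z\<close>.\<close>

lemma eventually_min_frac_nhds:
  fixes t z :: "'a::t2_space \<Rightarrow> real"
  assumes "isCont t x" "isCont z x" "t x \<notin> \<int>" "frac (t x) \<noteq> z x"
  shows "eventually (\<lambda>y. sq (t y) = sq (t x) \<and>
    min (z y) (frac (t y)) = (if frac (t x) < z x then t y - of_int \<lfloor>t x\<rfloor> else z y)) (nhds x)"
proof -
  have "isCont (\<lambda>y. (t y - of_int \<lfloor>t x\<rfloor>) - z y) x"
    by (intro continuous_intros assms)
  from eventually_sign_nhds[OF this] have "eventually (\<lambda>y. ((t y - of_int \<lfloor>t x\<rfloor>) - z y < 0) =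
      ((t x - of_int \<lfloor>t x\<rfloor>) - z x < 0)) (nhds x)"
    using assms(4) by (simp add: frac_def)
  then show ?thesis
    using eventually_floor_nhds[OF assms(1,3)]
    by eventually_elim (auto simp: sq_def frac_def)
qed

text \<open>The number \<open>a\<close>, 0 or 1, replaces the case split in \<open>min\<close>, so
  that one formula covers both sides of the wall and enters the determinants as a
  polynomial.\<close>

lemma has_derivative_fold1:
  fixes t z :: "'a::real_normed_vector \<Rightarrow> real"
  assumes t: "(t has_derivative t') (at x)" and z: "(z has_derivative z') (at x)"
    and g: "t x \<notin> \<int>" "frac (t x) \<noteq> z x"
    and a: "a = of_bool (frac (t x) < z x)"
  shows "((\<lambda>y. fold1 (t y) (z y)) has_derivative
    (\<lambda>h. sq (t x) * (z' h - 2 * (a * t' h + (1 - a) * z' h)))) (at x)"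
proof (rule has_derivative_transform_nhds)
  show "((\<lambda>y. sq (t x) * (z y - 2 * (a * (t y - of_int \<lfloor>t x\<rfloor>) + (1 - a) * z y))) has_derivative
    (\<lambda>h. sq (t x) * (z' h - 2 * (a * t' h + (1 - a) * z' h)))) (at x)"
    using has_derivative_diff[OF t has_derivative_const]
    by (intro has_derivative_mult_right has_derivative_diff has_derivative_add z) simp
  show "eventually (\<lambda>y. sq (t x) * (z y - 2 * (a * (t y - of_int \<lfloor>t x\<rfloor>) + (1 - a) * z y))
      = fold1 (t y) (z y)) (nhds x)"
    using eventually_min_frac_nhds[OF has_derivative_continuous[OF t] has_derivative_continuous[OF z] g]
    by eventually_elim (simp add: fold1_def a)
qed

lemma has_derivative_fold2:
  fixes s t z :: "'a::real_normed_vector \<Rightarrow> real"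
  assumes s: "(s has_derivative s') (at x)" and t: "(t has_derivative t') (at x)"
    and z: "(z has_derivative z') (at x)"
    and gs: "s x \<notin> \<int>" "frac (s x) \<noteq> z x" and gt: "t x \<notin> \<int>" "frac (t x) \<noteq> z x"
    and st: "frac (s x) \<noteq> frac (t x)"
    and a: "a = of_bool (frac (s x) < z x)" and b: "b = of_bool (frac (t x) < z x)"
    and k: "k = (if frac (s x) < frac (t x) then -1 else 1)"
  shows "((\<lambda>y. fold2 (s y) (t y) (z y)) has_derivative
    (\<lambda>h. sq (s x) * sq (t x) *
      (z' h - 2 * (k * ((a * s' h + (1 - a) * z' h) - (b * t' h + (1 - b) * z' h)))))) (at x)"
proof (rule has_derivative_transform_nhds)
  note cont = has_derivative_continuous[OF s] has_derivative_continuous[OF t]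
    has_derivative_continuous[OF z]
  let ?f = "\<lambda>y. sq (s x) * sq (t x) * (z y - 2 * (k * ((a * (s y - of_int \<lfloor>s x\<rfloor>) + (1 - a) * z y)
    - (b * (t y - of_int \<lfloor>t x\<rfloor>) + (1 - b) * z y))))"
  show "(?f has_derivative (\<lambda>h. sq (s x) * sq (t x) *
      (z' h - 2 * (k * ((a * s' h + (1 - a) * z' h) - (b * t' h + (1 - b) * z' h)))))) (at x)"
    using has_derivative_diff[OF s has_derivative_const] has_derivative_diff[OF t has_derivative_const]
    by (intro has_derivative_mult_right has_derivative_diff has_derivative_add z) simp_all
  have "isCont (\<lambda>y. (s y - of_int \<lfloor>s x\<rfloor>) - (t y - of_int \<lfloor>t x\<rfloor>)) x"
    by (intro continuous_intros cont)
  from eventually_sign_nhds[OF this] have "eventually (\<lambda>y.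
      ((s y - of_int \<lfloor>s x\<rfloor>) - (t y - of_int \<lfloor>t x\<rfloor>) < 0) = (frac (s x) - frac (t x) < 0)) (nhds x)"
    using st by (simp add: frac_def)
  then show "eventually (\<lambda>y. ?f y = fold2 (s y) (t y) (z y)) (nhds x)"
    using eventually_min_frac_nhds[OF cont(1,3) gs] eventually_min_frac_nhds[OF cont(2,3) gt]
  proof eventually_elim
    case (elim y)
    define p where "p = min (z y) (frac (s y))"
    define q where "q = min (z y) (frac (t y))"
    have p: "p = (if frac (s x) < z x then s y - of_int \<lfloor>s x\<rfloor> else z y)"
      and q: "q = (if frac (t x) < z x then t y - of_int \<lfloor>t x\<rfloor> else z y)"
      using elim by (simp_all only: p_def q_def)
    moreover have "p \<le> z y" "q \<le> z y"
      by (simp_all add: p_def q_def)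
    moreover have "(s y - of_int \<lfloor>s x\<rfloor> < t y - of_int \<lfloor>t x\<rfloor>) = (frac (s x) < frac (t x))"
      using elim(1) by simp
    \<comment> \<open>If both minima equal \<open>z y\<close>, the difference is 0 and either sign
      will do; otherwise the order of the fractional parts decides.\<close>
    ultimately have "\<bar>p - q\<bar> = k * (p - q)"
      using k by (auto split: if_splits)
    moreover have "p = a * (s y - of_int \<lfloor>s x\<rfloor>) + (1 - a) * z y"
      "q = b * (t y - of_int \<lfloor>t x\<rfloor>) + (1 - b) * z y"
      using p q a b by simp_all
    ultimately show ?case
      unfolding fold2_def p_def[symmetric] q_def[symmetric] using elim by simp
  qed
qed

section \<open>The Jacobian determinants\<close>

text \<open>
  In the next two lemmas \<open>s\<close> and \<open>t\<close> are the values of \<open>sq\<close> at \<open>x\<close> and \<open>y\<close>, the numbers \<open>a\<close> and \<open>b\<close> tell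
  whether the fractional parts of \<open>x\<close> and \<open>y\<close> are below that of \<open>z\<close>, and \<open>k\<close> is the sign of the
  difference of the fractional parts of \<open>x\<close> and \<open>y\<close>.
\<close>

lemma layer_det_ge_1:
  fixes s t a b k :: real
  assumes "s = 1 \<or> s = -1" "t = 1 \<or> t = -1" "k = 1 \<or> k = -1" "a = 0 \<or> a = 1" "b = 0 \<or> b = 1"
    and "a = 1 \<Longrightarrow> b = 0 \<Longrightarrow> k = -1" "a = 0 \<Longrightarrow> b = 1 \<Longrightarrow> k = 1"
  defines "p \<equiv> 3 * s * (2 * a - 1)" and "q \<equiv> 3 * s * (2 * a - 1) + t * (2 * b - 1)"
    and "c1 \<equiv> 2 * s - 2 * s * t * k - 2 * s * a - 4 * s * t * k * a"
    and "c2 \<equiv> 2 * s * t * k + 4 * s * t * k * b"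
    and "c3 \<equiv> s * (2 * a - 1) + 2 * s * t * (1 - 2 * k * (b - a))"
  shows "(1 - 6 * s * a) * ((1 - 2 * t * b) * c3 - q * c2)
      + p * (- 6 * s * a * c2 - (1 - 2 * t * b) * c1) \<ge> 1"
    and "\<forall>x\<in>{1 - 6 * s * a, 0, p, - 6 * s * a, 1 - 2 * t * b, q, c1, c2, c3}. \<bar>x\<bar> \<le> 20"
  \<comment> \<open>The order constraints leave six triples \<open>(a, b, k)\<close>, one for each
    order of the two fractional parts and the height. With four sign pairs \<open>(s, t)\<close>
    these are the 24 simplices, each a numerical check.\<close>
  using assms(1-7) unfolding assms(8-)
  by (elim disjE; simp)+

lemma end_det_ge_cube:
  fixes s t k u v w e :: real
  assumes s: "s = 1 \<or> s = -1" and t: "t = 1 \<or> t = -1" and k: "k = 1 \<or> k = -1"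
    and v: "\<bar>v\<bar> \<le> 1" and w: "\<bar>w\<bar> \<le> 1" and e: "e \<ge> 1"
    and one: "s * t * w + t * k * v - s * k * u = 1"
  shows "(1 - 6 * s * e) * ((1 - 2 * t * e) * (3 * e * w) - e * (3 * u + v) * (6 * s * t * k * e))
      + 3 * e * u * (- 6 * s * e * (6 * s * t * k * e) - (1 - 2 * t * e) * (- 6 * s * t * k * e)) \<ge> e ^ 3"
    (is "?d \<ge> _")
proof -
  define c where "c = - 18 * s * w - 6 * t * w - 6 * s * t * k * v"
  \<comment> \<open>The coefficient of \<open>e ^ 3\<close> is the determinant formed by the two
    partial derivatives of \<open>h = (3 u, 3 u + v, 3 w)\<close> and \<open>h\<close> itself. It is
    36 times the left side of \<open>one\<close>, which is the equation of the plane through the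
    current face of the tetrahedron.\<close>
  have "?d = 3 * w * e + c * e ^ 2 + 36 * (s * t * w + t * k * v - s * k * u) * e ^ 3"
    using s t k unfolding c_def
    by (elim disjE) (simp_all add: algebra_simps power2_eq_square power3_eq_cube)
  then have d: "?d = 3 * w * e + c * e ^ 2 + 36 * e ^ 3"
    using one by simp
  \<comment> \<open>30 = 18 + 6 + 6.\<close>
  have "c \<ge> -30"
    using s t k v w unfolding c_def by (elim disjE) (simp_all add: abs_le_iff)
  then have "c * e ^ 2 \<ge> - 30 * e ^ 2"
    by (intro mult_right_mono) auto
  moreover have "3 * w * e \<ge> - 3 * e"
    using w e by (intro mult_right_mono) (auto simp: abs_le_iff)
  moreover have "36 * e ^ 3 - 30 * e ^ 2 - 3 * e - e ^ 3 = e * ((e - 1) * (35 * e + 5) + 2)"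
    by (simp add: algebra_simps power2_eq_square power3_eq_cube)
  moreover have "e * ((e - 1) * (35 * e + 5) + 2) \<ge> 0"
    using e by simp
  ultimately show ?thesis
    unfolding d by linarith
qed

section \<open>The map\<close>

definition clamp01 :: "real \<Rightarrow> real" where
  "clamp01 z = max 0 (min 1 z)"

definition growth :: "real \<Rightarrow> real" where
  "growth z = exp (max 0 (z - 2))"

text \<open>The truncations glue the regions into one formula: \<open>clamp01 z\<close> is 1 once
  the vertical stretching is complete, \<open>c\<close> runs through [0, 1] in the layer, and
  \<open>e\<close> is 1 below height 2. At \<open>z = 1\<close> the image is the graph of
  \<open>3 - fold1 x 1 + fold2 x y 1\<close>, which is positive because the folds are bounded by 1.
  At \<open>z = 2\<close> the terms \<open>fold1 x 1\<close> in the height cancel and leave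
  \<open>3 + 3 * fold2 x y 1\<close>, matching the part above.\<close>

definition bend :: "real^3 \<Rightarrow> real^3" where
  "bend p = (let x = p $ 1; y = p $ 2; z = p $ 3; c = clamp01 (z - 1); e = growth z in
    vector [x + 3 * e * fold1 x c,
      y + e * (3 * fold1 x c + fold1 y c),
      min z 0 + clamp01 z * (3 - fold1 x 1 + fold2 x y 1)
        + fold1 x c + 2 * fold2 x y c + 3 * (e - 1) * fold2 x y 1])"

lemma fold1_0 [simp]: "fold1 t 0 = 0" and fold2_0 [simp]: "fold2 s t 0 = 0"
  using fold1_bound[of 0 t] fold2_bound[of 0 s t] by auto

lemma bend_below: "p $ 3 \<le> 0 \<Longrightarrow> bend p = p"
  by (simp add: bend_def Let_def clamp01_def growth_def vec_eq_iff forall_3)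

lemma bend_layer1:
  assumes "0 \<le> p $ 3" "p $ 3 \<le> 1"
  shows "bend p = vector [p $ 1, p $ 2, p $ 3 * (3 - fold1 (p $ 1) 1 + fold2 (p $ 1) (p $ 2) 1)]"
  using assms by (simp add: bend_def Let_def clamp01_def growth_def)

lemma bend_layer2:
  assumes "1 \<le> p $ 3" "p $ 3 \<le> 2"
  shows "bend p = vector [p $ 1 + 3 * fold1 (p $ 1) (p $ 3 - 1),
    p $ 2 + (3 * fold1 (p $ 1) (p $ 3 - 1) + fold1 (p $ 2) (p $ 3 - 1)),
    3 - fold1 (p $ 1) 1 + fold2 (p $ 1) (p $ 2) 1
      + fold1 (p $ 1) (p $ 3 - 1) + 2 * fold2 (p $ 1) (p $ 2) (p $ 3 - 1)]"
  using assms by (simp add: bend_def Let_def clamp01_def growth_def)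

lemma bend_above:
  assumes "2 \<le> p $ 3"
  shows "bend p = vector [p $ 1 + 3 * exp (p $ 3 - 2) * fold1 (p $ 1) 1,
    p $ 2 + exp (p $ 3 - 2) * (3 * fold1 (p $ 1) 1 + fold1 (p $ 2) 1),
    3 + 3 * exp (p $ 3 - 2) * fold2 (p $ 1) (p $ 2) 1]"
  using assms by (simp add: bend_def Let_def clamp01_def growth_def algebra_simps)

lemma lipschitz_on_balls_bend: "lipschitz_on_balls (\<lambda>p. bend p $ j)"
proof -
  have e: "lipschitz_on_balls (\<lambda>p::real^3. growth (p $ 3))"
    unfolding growth_def by (intro lipschitz_on_balls_exp lipschitz_on_balls_max
        lipschitz_on_balls_diff lipschitz_on_balls_nth lipschitz_on_balls_const)
  have r: "lipschitz_on_balls (\<lambda>p::real^3. clamp01 (p $ 3 - a))" for a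
    unfolding clamp01_def by (intro lipschitz_on_balls_min lipschitz_on_balls_max
        lipschitz_on_balls_diff lipschitz_on_balls_nth lipschitz_on_balls_const)
  have c: "0 \<le> clamp01 z" "clamp01 z \<le> 1" for z
    by (simp_all add: clamp01_def)
  note L = lipschitz_on_balls_add lipschitz_on_balls_diff lipschitz_on_balls_mult
    lipschitz_on_balls_min lipschitz_on_balls_nth lipschitz_on_balls_const
    lipschitz_on_balls_fold1 lipschitz_on_balls_fold2 e r[of 0, simplified] r[of 1]
  have "\<forall>j. lipschitz_on_balls (\<lambda>p. bend p $ j)"
    unfolding forall_3 bend_def Let_def vector_3
    by (intro conjI L) (simp_all add: c)
  then show ?thesis ..
qed

section \<open>Derivative and dilatation of the map\<close>

lemma has_derivative_nth: "((\<lambda>p::real^'n. p $ k) has_derivative (\<lambda>h. h $ k)) F"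
  by (rule bounded_linear_imp_has_derivative[OF bounded_linear_vec_nth])

text \<open>The common pattern of the four regions, with \<open>e = 1\<close> below height 2 and
  \<open>e = exp (z - 2)\<close> above. The determinant is expanded along the first row, and 180 = 9
  * 20 comes from \<open>dilatation_bound\<close>.\<close>

lemma bend_dilatationI:
  fixes f1 f2 f3 :: "real^3 \<Rightarrow> real"
  assumes "(f1 has_derivative (\<lambda>h. a1 * h $ 1 + a2 * h $ 2 + a3 * h $ 3)) (at p)"
    and "(f2 has_derivative (\<lambda>h. b1 * h $ 1 + b2 * h $ 2 + b3 * h $ 3)) (at p)"
    and "(f3 has_derivative (\<lambda>h. c1 * h $ 1 + c2 * h $ 2 + c3 * h $ 3)) (at p)"
    and "open S" "p \<in> S" "\<And>q. q \<in> S \<Longrightarrow> bend q = vector [f1 q, f2 q, f3 q]"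
    and "\<forall>x\<in>{a1, a2, a3, b1, b2, b3, c1, c2, c3}. \<bar>x\<bar> \<le> 20 * e"
    and "a1 * (b2 * c3 - b3 * c2) - a2 * (b1 * c3 - b3 * c1) + a3 * (b1 * c2 - b2 * c1) \<ge> e ^ 3"
    and "e > 0"
  shows "\<exists>M. (bend has_derivative (*v) M) (at p) \<and> onorm ((*v) M) ^ 3 \<le> 180 ^ 3 * det M"
proof (intro exI conjI)
  let ?M = "vector [vector [a1, a2, a3], vector [b1, b2, b3], vector [c1, c2, c3]] :: real^3^3"
  show "(bend has_derivative (*v) ?M) (at p)"
    using has_derivative_transform_within_open[OF has_derivative_vector_3[OF assms(1-3)] assms(4,5)]
      assms(6) by simp
  have "\<forall>i j. \<bar>?M $ i $ j\<bar> \<le> 20 * e"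
    unfolding forall_3 vector_3 using assms(7) by simp
  moreover have "det ?M \<ge> e ^ 3"
    unfolding det_3 vector_3 using assms(8) by (simp add: algebra_simps)
  ultimately show "onorm ((*v) ?M) ^ 3 \<le> 180 ^ 3 * det ?M"
    using dilatation_bound[of ?M 20 e] assms(9) by simp
qed

lemma frac_eq_imp_diff_Ints:
  assumes "frac s = t"
  shows "s - t \<in> \<int>"
proof -
  have "s - t = of_int \<lfloor>s\<rfloor>"
    using assms by (simp add: frac_def)
  then show ?thesis
    by simp
qed

lemma frac_eq_frac_imp_diff_Ints:
  assumes "frac s = frac t"
  shows "s - t \<in> \<int>"
proof -
  have "s - t = of_int (\<lfloor>s\<rfloor> - \<lfloor>t\<rfloor>)"
    using assms by (simp add: frac_def)
  then show ?thesis
    by (metis Ints_of_int)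
qed

text \<open>The six assumptions keep \<open>p\<close> off the walls of the triangulation and off the
  planes between the regions, so near \<open>p\<close> the map is given by a single smooth
  formula.\<close>

lemma bend_dilatation:
  fixes p :: "real^3"
  assumes x: "p $ 1 \<notin> \<int>" and y: "p $ 2 \<notin> \<int>" and z: "p $ 3 \<notin> \<int>"
    and xy: "p $ 1 - p $ 2 \<notin> \<int>" and xz: "p $ 1 - p $ 3 \<notin> \<int>" and yz: "p $ 2 - p $ 3 \<notin> \<int>"
  shows "\<exists>M. (bend has_derivative (*v) M) (at p) \<and> onorm ((*v) M) ^ 3 \<le> 180 ^ 3 * det M"
proof -
  define s where "s = sq (p $ 1)"
  define t where "t = sq (p $ 2)"
  define k where "k = (if frac (p $ 1) < frac (p $ 2) then -1 else 1 :: real)"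
  define a where "a = (of_bool (frac (p $ 1) < p $ 3 - 1) :: real)"
  define b where "b = (of_bool (frac (p $ 2) < p $ 3 - 1) :: real)"
  have s: "s = 1 \<or> s = -1" and t: "t = 1 \<or> t = -1" and k: "k = 1 \<or> k = -1"
    and a: "a = 0 \<or> a = 1" and b: "b = 0 \<or> b = 1"
    by (auto simp: s_def t_def k_def a_def b_def sq_def)
  have frac_xy: "frac (p $ 1) \<noteq> frac (p $ 2)"
    using xy frac_eq_frac_imp_diff_Ints by blast
  have frac_xz: "frac (p $ 1) \<noteq> p $ 3 - 1"
  proof
    assume "frac (p $ 1) = p $ 3 - 1"
    from Ints_diff[OF frac_eq_imp_diff_Ints[OF this] Ints_1] xz show False
      by (simp add: algebra_simps)
  qed
  have frac_yz: "frac (p $ 2) \<noteq> p $ 3 - 1"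
  proof
    assume "frac (p $ 2) = p $ 3 - 1"
    from Ints_diff[OF frac_eq_imp_diff_Ints[OF this] Ints_1] yz show False
      by (simp add: algebra_simps)
  qed
  have lt1: "frac (p $ 1) < 1" "frac (p $ 2) < 1" "frac (p $ 1) \<noteq> 1" "frac (p $ 2) \<noteq> 1"
    using frac_lt_1[of "p $ 1"] frac_lt_1[of "p $ 2"] by auto
  \<comment> \<open>Fractional parts always lie below 1, so at level 1 both selectors are 1 and the
    folds are locally affine in the two horizontal coordinates alone.\<close>
  have u: "((\<lambda>q. fold1 (q $ 1) 1) has_derivative (\<lambda>h. - 2 * s * h $ 1)) (at p)"
    by (rule has_derivative_eq_rhs[OF has_derivative_fold1[where a = 1, OF has_derivative_nth has_derivative_const x]])
       (auto simp: lt1 s_def)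
  have v: "((\<lambda>q. fold1 (q $ 2) 1) has_derivative (\<lambda>h. - 2 * t * h $ 2)) (at p)"
    by (rule has_derivative_eq_rhs[OF has_derivative_fold1[where a = 1, OF has_derivative_nth has_derivative_const y]])
       (auto simp: lt1 t_def)
  have w: "((\<lambda>q. fold2 (q $ 1) (q $ 2) 1) has_derivative
      (\<lambda>h. - 2 * s * t * k * h $ 1 + 2 * s * t * k * h $ 2)) (at p)"
    by (rule has_derivative_eq_rhs[OF has_derivative_fold2[where a = 1 and b = 1,
          OF has_derivative_nth has_derivative_nth has_derivative_const x _ y _ frac_xy _ _ k_def]])
       (auto simp: lt1 s_def t_def algebra_simps)
  note c = has_derivative_diff[OF has_derivative_nth has_derivative_const]
  have f: "((\<lambda>q. fold1 (q $ 1) (q $ 3 - 1)) has_derivative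
      (\<lambda>h. - 2 * s * a * h $ 1 + s * (2 * a - 1) * h $ 3)) (at p)"
    by (rule has_derivative_eq_rhs[OF has_derivative_fold1[OF has_derivative_nth c x frac_xz a_def]])
       (simp add: s_def fun_eq_iff algebra_simps)
  have g: "((\<lambda>q. fold1 (q $ 2) (q $ 3 - 1)) has_derivative
      (\<lambda>h. - 2 * t * b * h $ 2 + t * (2 * b - 1) * h $ 3)) (at p)"
    by (rule has_derivative_eq_rhs[OF has_derivative_fold1[OF has_derivative_nth c y frac_yz b_def]])
       (simp add: t_def fun_eq_iff algebra_simps)
  have r: "((\<lambda>q. fold2 (q $ 1) (q $ 2) (q $ 3 - 1)) has_derivative
      (\<lambda>h. - 2 * s * t * k * a * h $ 1 + 2 * s * t * k * b * h $ 2
        + s * t * (1 - 2 * k * (b - a)) * h $ 3)) (at p)"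
    by (rule has_derivative_eq_rhs[OF has_derivative_fold2[OF has_derivative_nth has_derivative_nth c
          x frac_xz y frac_yz frac_xy a_def b_def k_def]])
       (simp add: s_def t_def fun_eq_iff algebra_simps)
  have "p $ 3 \<noteq> 0" "p $ 3 \<noteq> 1" "p $ 3 \<noteq> 2"
    using z by auto
  then consider "p $ 3 < 0" | "0 < p $ 3" "p $ 3 < 1" | "1 < p $ 3" "p $ 3 < 2" | "2 < p $ 3"
    by linarith
  then show ?thesis
  proof cases
    case 1
    show ?thesis
    proof (rule bend_dilatationI[where e = 1])
      show "((\<lambda>q. q $ 1) has_derivative (\<lambda>h. 1 * h $ 1 + 0 * h $ 2 + 0 * h $ 3)) (at p)"
        "((\<lambda>q. q $ 2) has_derivative (\<lambda>h. 0 * h $ 1 + 1 * h $ 2 + 0 * h $ 3)) (at p)"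
        "((\<lambda>q. q $ 3) has_derivative (\<lambda>h. 0 * h $ 1 + 0 * h $ 2 + 1 * h $ 3)) (at p)"
        using has_derivative_nth by simp_all
      show "open {q::real^3. q $ 3 < 0}"
        by (intro open_Collect_less continuous_intros)
      show "bend q = vector [q $ 1, q $ 2, q $ 3]" if "q \<in> {q. q $ 3 < 0}" for q
        using that by (simp add: bend_below vec_eq_iff forall_3)
    qed (use 1 in auto)
  next
    case 2
    \<comment> \<open>The Jacobian matrix of this region is triangular with diagonal 1, 1,
      \<open>H\<close>, so its determinant is \<open>H\<close>.\<close>
    define H where "H = 3 - fold1 (p $ 1) 1 + fold2 (p $ 1) (p $ 2) 1"
    have H: "1 \<le> H" "H \<le> 5"
      using fold1_bound[of 1 "p $ 1"] fold2_bound[of 1 "p $ 1" "p $ 2"] by (auto simp: H_def)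
    show ?thesis
    proof (rule bend_dilatationI[where e = 1])
      show "((\<lambda>q. q $ 1) has_derivative (\<lambda>h. 1 * h $ 1 + 0 * h $ 2 + 0 * h $ 3)) (at p)"
        "((\<lambda>q. q $ 2) has_derivative (\<lambda>h. 0 * h $ 1 + 1 * h $ 2 + 0 * h $ 3)) (at p)"
        using has_derivative_nth by simp_all
      show "((\<lambda>q. q $ 3 * (3 - fold1 (q $ 1) 1 + fold2 (q $ 1) (q $ 2) 1)) has_derivative
          (\<lambda>h. p $ 3 * (2 * s - 2 * s * t * k) * h $ 1 + p $ 3 * (2 * s * t * k) * h $ 2 + H * h $ 3)) (at p)"
        by (rule has_derivative_eq_rhs[OF has_derivative_mult[OF has_derivative_nth
              has_derivative_add[OF has_derivative_diff[OF has_derivative_const u] w]]])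
           (simp add: H_def fun_eq_iff algebra_simps)
      show "open {q::real^3. 0 < q $ 3 \<and> q $ 3 < 1}"
        by (intro open_Collect_conj open_Collect_less continuous_intros)
      show "bend q = vector [q $ 1, q $ 2, q $ 3 * (3 - fold1 (q $ 1) 1 + fold2 (q $ 1) (q $ 2) 1)]"
        if "q \<in> {q. 0 < q $ 3 \<and> q $ 3 < 1}" for q
        using that bend_layer1[of q] by simp
      have "\<bar>p $ 3 * (2 * s - 2 * s * t * k)\<bar> \<le> 1 * 4" "\<bar>p $ 3 * (2 * s * t * k)\<bar> \<le> 1 * 2"
        unfolding abs_mult[of "p $ 3"]
        using 2 s t k by (intro mult_mono; elim disjE; simp)+
      then show "\<forall>x\<in>{1, 0, 0, 0, 1, 0, p $ 3 * (2 * s - 2 * s * t * k), p $ 3 * (2 * s * t * k), H}.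
          \<bar>x\<bar> \<le> 20 * 1"
        using H by auto
    qed (use 2 H in auto)
  next
    case 3
    let ?c1 = "2 * s - 2 * s * t * k - 2 * s * a - 4 * s * t * k * a"
    let ?c2 = "2 * s * t * k + 4 * s * t * k * b"
    let ?c3 = "s * (2 * a - 1) + 2 * s * t * (1 - 2 * k * (b - a))"
    let ?p = "3 * s * (2 * a - 1)" and ?q = "3 * s * (2 * a - 1) + t * (2 * b - 1)"
    \<comment> \<open>Here \<open>p $ 3 - 1\<close> separates the two fractional parts, which
      determines their order and hence \<open>k\<close>.\<close>
    have ab: "k = -1" if "a = 1" "b = 0"
      using that frac_xy by (auto simp: a_def b_def k_def split: if_splits)
    have ba: "k = 1" if "a = 0" "b = 1"
      using that frac_xy by (auto simp: a_def b_def k_def split: if_splits)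
    note det = layer_det_ge_1[OF s t k a b ab ba]
    show ?thesis
    proof (rule bend_dilatationI[where e = 1])
      show "((\<lambda>q. q $ 1 + 3 * fold1 (q $ 1) (q $ 3 - 1)) has_derivative
          (\<lambda>h. (1 - 6 * s * a) * h $ 1 + 0 * h $ 2 + ?p * h $ 3)) (at p)"
        by (rule has_derivative_eq_rhs[OF has_derivative_add[OF has_derivative_nth
              has_derivative_mult_right[OF f]]])
           (simp add: fun_eq_iff algebra_simps)
      show "((\<lambda>q. q $ 2 + (3 * fold1 (q $ 1) (q $ 3 - 1) + fold1 (q $ 2) (q $ 3 - 1))) has_derivative
          (\<lambda>h. (- 6 * s * a) * h $ 1 + (1 - 2 * t * b) * h $ 2 + ?q * h $ 3)) (at p)"
        by (rule has_derivative_eq_rhs[OF has_derivative_add[OF has_derivative_nth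
              has_derivative_add[OF has_derivative_mult_right[OF f] g]]])
           (simp add: fun_eq_iff algebra_simps)
      show "((\<lambda>q. 3 - fold1 (q $ 1) 1 + fold2 (q $ 1) (q $ 2) 1
          + fold1 (q $ 1) (q $ 3 - 1) + 2 * fold2 (q $ 1) (q $ 2) (q $ 3 - 1)) has_derivative
          (\<lambda>h. ?c1 * h $ 1 + ?c2 * h $ 2 + ?c3 * h $ 3)) (at p)"
        by (rule has_derivative_eq_rhs[OF has_derivative_add[OF has_derivative_add[OF has_derivative_add[OF
              has_derivative_diff[OF has_derivative_const u] w] f] has_derivative_mult_right[OF r]]])
           (simp add: fun_eq_iff algebra_simps)
      show "open {q::real^3. 1 < q $ 3 \<and> q $ 3 < 2}"
        by (intro open_Collect_conj open_Collect_less continuous_intros)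
      show "bend q = vector [q $ 1 + 3 * fold1 (q $ 1) (q $ 3 - 1),
          q $ 2 + (3 * fold1 (q $ 1) (q $ 3 - 1) + fold1 (q $ 2) (q $ 3 - 1)),
          3 - fold1 (q $ 1) 1 + fold2 (q $ 1) (q $ 2) 1
            + fold1 (q $ 1) (q $ 3 - 1) + 2 * fold2 (q $ 1) (q $ 2) (q $ 3 - 1)]"
        if "q \<in> {q. 1 < q $ 3 \<and> q $ 3 < 2}" for q
        using that bend_layer2[of q] by simp
      show "\<forall>x\<in>{1 - 6 * s * a, 0, ?p, - 6 * s * a, 1 - 2 * t * b, ?q, ?c1, ?c2, ?c3}. \<bar>x\<bar> \<le> 20 * 1"
        unfolding mult_1_right by (rule det(2))
      show "(1 - 6 * s * a) * ((1 - 2 * t * b) * ?c3 - ?q * ?c2) - 0 * (- 6 * s * a * ?c3 - ?q * ?c1)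
          + ?p * (- 6 * s * a * ?c2 - (1 - 2 * t * b) * ?c1) \<ge> 1 ^ 3"
        unfolding mult_zero_left diff_zero power_one by (rule det(1))
    qed (use 3 in auto)
  next
    case 4
    define e where "e = exp (p $ 3 - 2)"
    define U where "U = fold1 (p $ 1) 1"
    define V where "V = fold1 (p $ 2) 1"
    define W where "W = fold2 (p $ 1) (p $ 2) 1"
    have e: "e \<ge> 1"
      using 4 by (simp add: e_def)
    have bounds: "\<bar>U\<bar> \<le> 1" "\<bar>V\<bar> \<le> 1" "\<bar>W\<bar> \<le> 1"
      by (simp_all add: U_def V_def W_def fold1_bound fold2_bound)
    \<comment> \<open>One has \<open>s * U = 1 - 2 * frac (p $ 1)\<close> and
      \<open>t * V = 1 - 2 * frac (p $ 2)\<close>, while \<open>s * t * W\<close> is 1 minus twice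
      the distance of these fractional parts. As \<open>k\<close> is the sign of their difference,
      everything but 1 cancels.\<close>
    have one: "s * t * W + t * k * V - s * k * U = 1"
      using s t lt1 unfolding U_def V_def W_def fold1_def fold2_def s_def[symmetric] t_def[symmetric]
      by (elim disjE) (auto simp: k_def)
    have de: "((\<lambda>q::real^3. exp (q $ 3 - 2)) has_derivative (\<lambda>h. e * h $ 3)) (at p)"
      by (rule has_derivative_eq_rhs[OF has_derivative_exp[OF c]]) (simp add: e_def mult.commute)
    show ?thesis
    proof (rule bend_dilatationI[where e = e])
      show "((\<lambda>q. q $ 1 + 3 * exp (q $ 3 - 2) * fold1 (q $ 1) 1) has_derivative
          (\<lambda>h. (1 - 6 * s * e) * h $ 1 + 0 * h $ 2 + (3 * e * U) * h $ 3)) (at p)"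
        by (rule has_derivative_eq_rhs[OF has_derivative_add[OF has_derivative_nth
              has_derivative_mult[OF has_derivative_mult_right[OF de] u]]])
           (simp add: fun_eq_iff algebra_simps e_def U_def)
      show "((\<lambda>q. q $ 2 + exp (q $ 3 - 2) * (3 * fold1 (q $ 1) 1 + fold1 (q $ 2) 1)) has_derivative
          (\<lambda>h. (- 6 * s * e) * h $ 1 + (1 - 2 * t * e) * h $ 2 + (e * (3 * U + V)) * h $ 3)) (at p)"
        by (rule has_derivative_eq_rhs[OF has_derivative_add[OF has_derivative_nth
              has_derivative_mult[OF de has_derivative_add[OF has_derivative_mult_right[OF u] v]]]])
           (simp add: fun_eq_iff algebra_simps e_def U_def V_def)
      show "((\<lambda>q. 3 + 3 * exp (q $ 3 - 2) * fold2 (q $ 1) (q $ 2) 1) has_derivative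
          (\<lambda>h. (- 6 * s * t * k * e) * h $ 1 + (6 * s * t * k * e) * h $ 2 + (3 * e * W) * h $ 3)) (at p)"
        by (rule has_derivative_eq_rhs[OF has_derivative_add[OF has_derivative_const
              has_derivative_mult[OF has_derivative_mult_right[OF de] w]]])
           (simp add: fun_eq_iff algebra_simps e_def W_def)
      show "open {q::real^3. 2 < q $ 3}"
        by (intro open_Collect_less continuous_intros)
      show "bend q = vector [q $ 1 + 3 * exp (q $ 3 - 2) * fold1 (q $ 1) 1,
          q $ 2 + exp (q $ 3 - 2) * (3 * fold1 (q $ 1) 1 + fold1 (q $ 2) 1),
          3 + 3 * exp (q $ 3 - 2) * fold2 (q $ 1) (q $ 2) 1]"
        if "q \<in> {q. 2 < q $ 3}" for q
        using that bend_above[of q] by simp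
      have *: "\<bar>c * e\<bar> \<le> 20 * e" if "\<bar>c\<bar> \<le> 20" for c
        unfolding abs_mult using that e by (intro mult_mono) auto
      have "\<bar>3 * U + V\<bar> \<le> 20" "\<bar>3 * U\<bar> \<le> 20" "\<bar>3 * W\<bar> \<le> 20"
        using bounds by linarith+
      from this[THEN *] have "\<bar>e * (3 * U + V)\<bar> \<le> 20 * e" "\<bar>3 * e * U\<bar> \<le> 20 * e" "\<bar>3 * e * W\<bar> \<le> 20 * e"
        by (simp_all add: mult.assoc mult.commute[of e] mult.left_commute[of e])
      moreover have "\<bar>1 - 6 * s * e\<bar> \<le> 20 * e" "\<bar>- 6 * s * e\<bar> \<le> 20 * e" "\<bar>1 - 2 * t * e\<bar> \<le> 20 * e"
        "\<bar>- 6 * s * t * k * e\<bar> \<le> 20 * e" "\<bar>6 * s * t * k * e\<bar> \<le> 20 * e"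
        using s t k e by (elim disjE; simp)+
      ultimately show "\<forall>x\<in>{1 - 6 * s * e, 0, 3 * e * U, - 6 * s * e, 1 - 2 * t * e, e * (3 * U + V),
          - 6 * s * t * k * e, 6 * s * t * k * e, 3 * e * W}. \<bar>x\<bar> \<le> 20 * e"
        using e by simp
      show "(1 - 6 * s * e) * ((1 - 2 * t * e) * (3 * e * W) - e * (3 * U + V) * (6 * s * t * k * e))
          - 0 * (- 6 * s * e * (3 * e * W) - e * (3 * U + V) * (- 6 * s * t * k * e))
          + 3 * e * U * (- 6 * s * e * (6 * s * t * k * e) - (1 - 2 * t * e) * (- 6 * s * t * k * e)) \<ge> e ^ 3"
        unfolding mult_zero_left diff_zero by (rule end_det_ge_cube[OF s t k bounds(2,3) e one])
    qed (use 4 e in auto)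
  qed
qed

lemma quasiregular_bend: "quasiregular bend"
proof (rule quasiregularI[where K = "180 ^ 3"])
  show "lipschitz_on_balls (\<lambda>x. bend x $ j)" for j
    by (rule lipschitz_on_balls_bend)
  have AE: "AE x in lebesgue. a \<bullet> x \<notin> \<int>" if "a $ k \<noteq> 0" for a :: "real^3" and k
    using that by (intro AE_inner_not_Ints) auto
  have 1: "AE x::real^3 in lebesgue. x $ k \<notin> \<int>" for k
  proof -
    have "(axis k 1 :: real^3) $ k \<noteq> 0"
      by (simp add: axis_def)
    from AE[OF this] show ?thesis
      by (simp add: inner_axis')
  qed
  have 2: "AE x::real^3 in lebesgue. x $ k - x $ l \<notin> \<int>" if "k \<noteq> l" for k l
  proof -
    have "(axis k 1 - axis l 1 :: real^3) $ k \<noteq> 0"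
      using that by (simp add: axis_def)
    from AE[OF this] show ?thesis
      by (simp add: inner_diff_left inner_axis')
  qed
  have "(1::3) \<noteq> 2" "(1::3) \<noteq> 3" "(2::3) \<noteq> 3"
    by simp_all
  note this[THEN 2]
  with 1[of 1] 1[of 2] 1[of 3]
  show "AE x in lebesgue. \<exists>M. (bend has_derivative (*v) M) (at x) \<and> onorm ((*v) M) ^ 3 \<le> 180 ^ 3 * det M"
    by eventually_elim (rule bend_dilatation)
qed simp

section \<open>Behaviour at infinity\<close>

lemma bend_bounded_far_away: "\<exists>x. norm x \<ge> B \<and> norm (bend x) \<le> 1"
proof -
  obtain n :: nat where n: "B \<le> real n"
    using real_arch_simple by blast
  define e where "e = 2 * real n + 2"
  \<comment> \<open>The height makes the growth factor \<open>e\<close>, and the first coordinate 1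
    / 2 makes \<open>fold1\<close> vanish there. The offset 1 / (2 e) gives \<open>fold2\<close> the
    value -1 / e, so the image has height 0. The even period \<open>2 * real n\<close> leaves the
    folds unchanged, and \<open>e = 2 * real n + 2\<close> makes the large terms of the second
    coordinate cancel.\<close>
  define x :: "real^3" where "x = vector [1 / 2, 1 + 1 / (2 * e) + 2 * real n, 2 + ln e]"
  have e: "e \<ge> 2" "exp (x $ 3 - 2) = e" "x $ 3 \<ge> 2"
    by (auto simp: e_def x_def)
  have f1: "\<lfloor>x $ 1\<rfloor> = 0" "frac (x $ 1) = 1 / 2"
    by (auto simp: x_def frac_def floor_eq_iff)
  have small: "0 < 1 / (2 * e)" "1 / (2 * e) \<le> 1 / 2"
    using e(1) by (simp_all add: field_simps)
  then have f2: "\<lfloor>x $ 2\<rfloor> = 2 * int n + 1"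
    by (intro floor_unique) (simp_all add: x_def)
  have f2': "frac (x $ 2) = 1 / (2 * e)"
    unfolding frac_def f2 by (simp add: x_def)
  have folds: "fold1 (x $ 1) 1 = 0" "fold1 (x $ 2) 1 = - (1 - 1 / e)" "fold2 (x $ 1) (x $ 2) 1 = - (1 / e)"
    unfolding fold1_def fold2_def sq_def f1 f2 f2' using small by simp_all
  have "x $ 1 + 3 * e * 0 = 1 / 2" "x $ 2 + e * (3 * 0 + - (1 - 1 / e)) = 1 / (2 * e)"
    "3 + 3 * e * - (1 / e) = 0"
    using e(1) by (simp_all add: x_def right_diff_distrib) (simp add: e_def)
  then have "bend x = vector [1 / 2, 1 / (2 * e), 0]"
    unfolding bend_above[OF e(3)] e(2) folds by (simp only:)
  then have "norm (bend x) \<le> 1 / 2 + 1 / (2 * e)"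
    using norm_le_l1_cart[of "bend x"] e(1) by (simp add: sum_3)
  also have "\<dots> \<le> 1"
    using small by linarith
  finally have "norm (bend x) \<le> 1" .
  moreover have "B \<le> norm x"
  proof -
    have "\<bar>x $ 2\<bar> \<le> norm x"
      by (rule component_le_norm_cart)
    moreover have "x $ 2 \<ge> real n"
      using e(1) by (simp add: x_def)
    ultimately show ?thesis
      using n by linarith
  qed
  ultimately show ?thesis
    by blast
qed

text \<open>Bounded values at arbitrarily distant points exclude the limit infinity; the identity on
  the lower half-space is unbounded and excludes finite limits.\<close>

lemma transcendental_type_bend: "transcendental_type bend"
  unfolding transcendental_type_def
proof
  show "\<not> filterlim bend at_infinity at_infinity"
  proof
    assume "filterlim bend at_infinity at_infinity"
    then have "eventually (\<lambda>x. norm (bend x) \<ge> 2) at_infinity"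
      by (auto simp: filterlim_at_infinity[of 0])
    then obtain B where "\<And>x. norm x \<ge> B \<Longrightarrow> norm (bend x) \<ge> 2"
      unfolding eventually_at_infinity by blast
    then show False
      using bend_bounded_far_away[of B] by force
  qed
  show "\<not> (\<exists>l. (bend \<longlongrightarrow> l) at_infinity)"
  proof
    assume "\<exists>l. (bend \<longlongrightarrow> l) at_infinity"
    then obtain l where "(bend \<longlongrightarrow> l) at_infinity"
      by blast
    then have "eventually (\<lambda>x. dist (bend x) l < 1) at_infinity"
      by (rule tendstoD) simp
    then obtain B where B: "\<And>x. norm x \<ge> B \<Longrightarrow> dist (bend x) l < 1"
      unfolding eventually_at_infinity by blast
    \<comment> \<open>This \<open>r\<close> exceeds both \<open>B\<close> and
      \<open>norm l + 1 / 2\<close>, and the point at depth \<open>r\<close> is fixed with distance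
      at least \<open>r - norm l\<close>, hence at least 1, from \<open>l\<close>.\<close>
    define r where "r = \<bar>B\<bar> + norm l + 1"
    define x :: "real^3" where "x = - r *\<^sub>R axis 3 1"
    have "r \<ge> 0"
      by (simp add: r_def)
    then have n: "norm x = r" and x3: "x $ 3 \<le> 0"
      by (simp add: x_def, simp add: x_def axis_def)
    from x3 have "bend x = x"
      by (rule bend_below)
    moreover have "dist (bend x) l < 1"
      using B[of x] n norm_ge_zero[of l] r_def by linarith
    ultimately show False
      using n r_def norm_triangle_ineq2[of x l] by (simp add: dist_norm)
  qed
qed

theorem theorem5:
  shows "\<exists>g :: real^3 \<Rightarrow> real^3.
    quasiregular g \<and> transcendental_type g \<and>
    (\<exists>H. half_space H \<and> (\<forall>x\<in>H. g x = x))"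
proof (intro exI conjI)
  show "quasiregular bend" "transcendental_type bend"
    by (rule quasiregular_bend transcendental_type_bend)+
  \<comment> \<open>The half-space is the open lower one, with normal vector
    \<open>- axis 3 1\<close> and bound 0.\<close>
  have "- axis 3 1 \<noteq> (0 :: real^3)"
    by (simp add: axis_eq_0_iff)
  then show "half_space {x. - axis 3 1 \<bullet> x > 0}"
    unfolding half_space_def by blast
  show "\<forall>x\<in>{x. - axis 3 1 \<bullet> x > 0}. bend x = x"
    by (simp add: inner_axis' bend_below)
qed

end
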